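(* Let $\omega$ be a non-quasianalytic weight function. Then the multiplication operator $M\colon\mathcal{O}_{M,\omega}(\mathbb{R}^N)\times\mathcal{S}'_\omega(\mathbb{R}^N)\to\mathcal{S}'_\omega(\mathbb{R}^N)$, $(f,T)\mapsto fT$, is discontinuous (i.e. not jointly continuous for the product topology).
   Context: Weights. A non-quasianalytic weight function is a continuous increasing function $\omega:[0,\infty)\to[0,\infty)$ such that: ($\alpha$) there is $K\ge 1$ with $\omega(2t)\le K(1+\omega(t))$ for all $t\ge 0$; ($\beta$) $\int_1^\infty \frac{\omega(t)}{1+t^2}\,dt<\infty$; ($\gamma$) there are $a\in\mathbb{R}$, $b>0$ with $\omega(t)\ge a+b\log(1+t)$ for all $t\ge 0$; ($\delta$) $\varphi_\omega(t)=\omega(e^t)$ is convex. It is assumed (normalization) that $\omega$ vanishes on $[0,1]$. For $x\in\mathbb{R}^N$, $\omega(x):=\omega(|x|)$. The Young conjugate is $\varphi^*_\omega(s):=\sup_{t\ge 0}\{st-\varphi_\omega(t)\}$, $s\ge 0$ (the value $+\infty$ is allowed, with $\exp(-\infty)=0$). Spaces. $\mathcal{S}_\omega(\mathbb{R}^N)$ is the set of all $f\in L^1(\mathbb{R}^N)$ such that $f,\hat f\in C^\infty(\mathbb{R}^N)$ and $\|\exp(\lambda\omega)\partial^\alpha f\|_\infty<\infty$, $\|\exp(\lambda\omega)\partial^\alpha\hat f\|_\infty<\infty$ for all $\lambda>0$, $\alpha\in\mathbb{N}_0^N$; it is a Fréchet space with the norms $q_{m,n}(f):=\sup_{\alpha}\|\exp(n\omega)\partial^\alpha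 f\|_\infty\exp\left(-m\varphi^*_\omega\left(\frac{|\alpha|}{m}\right)\right)$, $m,n\in\mathbb{N}$. $\mathcal{S}'_\omega(\mathbb{R}^N)$ is its strong dual. For $m,n\in\mathbb{N}$ let $\mathcal{O}^m_{n,\omega}(\mathbb{R}^N)$ be the space of all $f\in C^\infty(\mathbb{R}^N)$ with $r_{m,n}(f):=\sup_{\alpha\in\mathbb{N}_0^N}\sup_{x\in\mathbb{R}^N}|\partial^\alpha f(x)|\exp\left(-n\omega(x)-m\varphi^*_\omega\left(\frac{|\alpha|}{m}\right)\right)<\infty$, with norm $r_{m,n}$. Set $\mathcal{O}_{M,\omega}(\mathbb{R}^N):=\bigcap_{m}\bigcup_{n}\mathcal{O}^m_{n,\omega}(\mathbb{R}^N)$ with the topology of the projective limit over $m$ of the locally convex inductive limits $\mathrm{ind}_{n}\,\mathcal{O}^m_{n,\omega}(\mathbb{R}^N)$. For $f\in\mathcal{O}_{M,\omega}(\mathbb{R}^N)$ one has $fg\in\mathcal{S}_\omega(\mathbb{R}^N)$ for all $g\in\mathcal{S}_\omega(\mathbb{R}^N)$, with $g\mapsto fg$ continuous; for $T\in\mathcal{S}'_\omega(\mathbb{R}^N)$, $fT$ is defined by $\langle fT,g\rangle:=\langle T,fg\rangle$, $g\in\mathcal{S}_\omega(\mathbb{R}^N)$. *)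

theory Defs
  imports "HOL-Analysis.Analysis"
begin

section \<open>Locally convex spaces of complex-valued functions\<close>

text \<open>
  All spaces below (spaces of functions on \<open>\<real>\<^sup>N\<close> as well as dual spaces) are linear subspaces \<open>V\<close>
  of some full space \<open>'a \<Rightarrow> complex\<close> with the pointwise operations.
\<close>

text \<open>
  Seminorms take values in \<open>[0, \<infinity>]\<close>, so that suprema need no boundedness proviso; on the space
  \<open>V\<close> they are meant to be finite.
\<close>

definition seminorm_topology ::
    "('a \<Rightarrow> complex) set \<Rightarrow> (('a \<Rightarrow> complex) \<Rightarrow> ennreal) set \<Rightarrow> ('a \<Rightarrow> complex) topology" where
  "seminorm_topology V P = topology (\<lambda>U. U \<subseteq> V \<and>
     (\<forall>u\<in>U. \<exists>F e. finite F \<and> F \<subseteq> P \<and> e > 0 \<and>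
        (\<forall>v\<in>V. (\<forall>p\<in>F. p (\<lambda>x. v x - u x) < ennreal e) \<longrightarrow> v \<in> U)))"

lemma openin_seminorm_topology:
  "openin (seminorm_topology V P) U \<longleftrightarrow> U \<subseteq> V \<and>
     (\<forall>u\<in>U. \<exists>F e. finite F \<and> F \<subseteq> P \<and> e > 0 \<and>
        (\<forall>v\<in>V. (\<forall>p\<in>F. p (\<lambda>x. v x - u x) < ennreal e) \<longrightarrow> v \<in> U))"
proof -
  define near where
    "near u W \<longleftrightarrow> (\<exists>F e. finite F \<and> F \<subseteq> P \<and> e > 0 \<and>
        (\<forall>v\<in>V. (\<forall>p\<in>F. p (\<lambda>x. v x - u x) < ennreal e) \<longrightarrow> v \<in> W))" for u W
  have int: "near u (A \<inter> B)" if A: "near u A" and B: "near u B" for u A B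
  proof -
    obtain F e where F: "finite F" "F \<subseteq> P" "e > 0"
      "\<And>v. v \<in> V \<Longrightarrow> (\<And>p. p \<in> F \<Longrightarrow> p (\<lambda>x. v x - u x) < ennreal e) \<Longrightarrow> v \<in> A"
      using A unfolding near_def by auto
    obtain G d where G: "finite G" "G \<subseteq> P" "d > 0"
      "\<And>v. v \<in> V \<Longrightarrow> (\<And>p. p \<in> G \<Longrightarrow> p (\<lambda>x. v x - u x) < ennreal d) \<Longrightarrow> v \<in> B"
      using B unfolding near_def by auto
    have le: "ennreal (min e d) \<le> ennreal e" "ennreal (min e d) \<le> ennreal d"
      by (auto intro: ennreal_leI)
    have "v \<in> A \<inter> B" if v: "v \<in> V" "\<forall>p\<in>F \<union> G. p (\<lambda>x. v x - u x) < ennreal (min e d)" for v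
    proof
      show "v \<in> A"
        by (rule F(4)[OF v(1)]) (use v(2) le(1) in \<open>auto intro: less_le_trans\<close>)
      show "v \<in> B"
        by (rule G(4)[OF v(1)]) (use v(2) le(2) in \<open>auto intro: less_le_trans\<close>)
    qed
    then have "finite (F \<union> G) \<and> F \<union> G \<subseteq> P \<and> min e d > 0 \<and>
        (\<forall>v\<in>V. (\<forall>p\<in>F \<union> G. p (\<lambda>x. v x - u x) < ennreal (min e d)) \<longrightarrow> v \<in> A \<inter> B)"
      using F(1-3) G(1-3) by simp
    then show ?thesis
      unfolding near_def by (intro exI)
  qed
  have mono: "near u W" if A: "near u A" and sub: "A \<subseteq> W" for u A W
  proof -
    obtain F e where "finite F \<and> F \<subseteq> P \<and> e > 0 \<and>
        (\<forall>v\<in>V. (\<forall>p\<in>F. p (\<lambda>x. v x - u x) < ennreal e) \<longrightarrow> v \<in> A)"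
      using A unfolding near_def by (elim exE)
    then have "finite F \<and> F \<subseteq> P \<and> e > 0 \<and>
        (\<forall>v\<in>V. (\<forall>p\<in>F. p (\<lambda>x. v x - u x) < ennreal e) \<longrightarrow> v \<in> W)"
      using sub by (meson subsetD)
    then show ?thesis
      unfolding near_def by (intro exI)
  qed
  have "istopology (\<lambda>U. U \<subseteq> V \<and> (\<forall>u\<in>U. near u U))"
    unfolding istopology_def
  proof (intro conjI allI impI ballI)
    fix K u assume K: "\<forall>A\<in>K. A \<subseteq> V \<and> (\<forall>u\<in>A. near u A)" and "u \<in> \<Union>K"
    then obtain A where "A \<in> K" "u \<in> A" by blast
    then show "near u (\<Union>K)"
      using K mono[of u A "\<Union>K"] by blast
  qed (auto intro: int)
  then show ?thesis
    unfolding seminorm_topology_def near_def by (simp only: topology_inverse')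
qed

lemma topspace_seminorm_topology: "topspace (seminorm_topology V P) = V"
proof
  show "topspace (seminorm_topology V P) \<subseteq> V"
    using openin_topspace[of "seminorm_topology V P"] unfolding openin_seminorm_topology by simp
  have "openin (seminorm_topology V P) V"
    unfolding openin_seminorm_topology by (auto intro!: exI[of _ "{}"] exI[of _ "1::real"])
  then show "V \<subseteq> topspace (seminorm_topology V P)"
    by (rule openin_subset)
qed

definition seminorm_bounded ::
    "('a \<Rightarrow> complex) set \<Rightarrow> (('a \<Rightarrow> complex) \<Rightarrow> ennreal) set \<Rightarrow> ('a \<Rightarrow> complex) set \<Rightarrow> bool" where
  "seminorm_bounded V P B \<longleftrightarrow> B \<subseteq> V \<and> (\<forall>p\<in>P. (SUP f\<in>B. p f) < \<infinity>)"

text \<open>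
  Functionals on \<open>V\<close> are total functions in HOL; setting them to \<open>0\<close> outside \<open>V\<close> makes them unique.
\<close>

definition dual_space ::
    "('a \<Rightarrow> complex) set \<Rightarrow> (('a \<Rightarrow> complex) \<Rightarrow> ennreal) set \<Rightarrow> (('a \<Rightarrow> complex) \<Rightarrow> complex) set" where
  "dual_space V P = {T.
     (\<forall>f\<in>V. \<forall>g\<in>V. T (\<lambda>x. f x + g x) = T f + T g) \<and>
     (\<forall>c. \<forall>f\<in>V. T (\<lambda>x. c * f x) = c * T f) \<and>
     continuous_map (seminorm_topology V P) euclidean T \<and>
     (\<forall>f. f \<notin> V \<longrightarrow> T f = 0)}"

definition strong_dual_topology ::
    "('a \<Rightarrow> complex) set \<Rightarrow> (('a \<Rightarrow> complex) \<Rightarrow> ennreal) set \<Rightarrow> (('a \<Rightarrow> complex) \<Rightarrow> complex) topology" where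
  "strong_dual_topology V P = seminorm_topology (dual_space V P)
     {(\<lambda>T. SUP g\<in>B. ennreal (norm (T g))) | B. seminorm_bounded V P B}"

definition locally_convex_topology_on ::
    "('a \<Rightarrow> complex) set \<Rightarrow> ('a \<Rightarrow> complex) topology \<Rightarrow> bool" where
  "locally_convex_topology_on V \<tau> \<longleftrightarrow>
     topspace \<tau> = V \<and>
     continuous_map (prod_topology \<tau> \<tau>) \<tau> (\<lambda>(f, g). \<lambda>x. f x + g x) \<and>
     continuous_map (prod_topology euclidean \<tau>) \<tau> (\<lambda>(c, f). \<lambda>x. c * f x) \<and>
     (\<forall>U. openin \<tau> U \<and> (\<lambda>x. 0) \<in> U \<longrightarrow>
        (\<exists>C W. openin \<tau> W \<and> (\<lambda>x. 0) \<in> W \<and> W \<subseteq> C \<and> C \<subseteq> U \<and>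
           (\<forall>f\<in>C. \<forall>g\<in>C. \<forall>t\<in>{0..1::real}.
              (\<lambda>x. complex_of_real (1 - t) * f x + complex_of_real t * g x) \<in> C)))"

text \<open>
  The locally convex inductive limit of an increasing family of spaces \<open>X i\<close>: the supremum of all
  locally convex topologies on the union for which every inclusion is continuous.  This supremum
  is itself such a topology, hence the finest one.
\<close>

definition inductive_limit_topology ::
    "'i set \<Rightarrow> ('i \<Rightarrow> ('a \<Rightarrow> complex) topology) \<Rightarrow> ('a \<Rightarrow> complex) topology" where
  "inductive_limit_topology I X = topology_generated_by
     {U. \<exists>\<tau>. locally_convex_topology_on (\<Union>i\<in>I. topspace (X i)) \<tau> \<and>
             (\<forall>i\<in>I. continuous_map (X i) \<tau> (\<lambda>f. f)) \<and> openin \<tau> U}"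

text \<open>
  The projective limit of a decreasing family: the coarsest topology on the intersection for which
  every inclusion is continuous.
\<close>

definition projective_limit_topology ::
    "'i set \<Rightarrow> ('i \<Rightarrow> ('a \<Rightarrow> complex) topology) \<Rightarrow> ('a \<Rightarrow> complex) topology" where
  "projective_limit_topology I X = topology_generated_by
     {U \<inter> (\<Inter>i\<in>I. topspace (X i)) | U. \<exists>i\<in>I. openin (X i) U}"


section \<open>Partial derivatives and the Fourier transform\<close>

definition partial_deriv :: "'n::finite \<Rightarrow> (real^'n \<Rightarrow> complex) \<Rightarrow> real^'n \<Rightarrow> complex" where
  "partial_deriv i f x = vector_derivative (\<lambda>t. f (x + t *\<^sub>R axis i 1)) (at 0)"

text \<open>
  \<open>C\<^sup>\<infinity>\<close>: all iterated partial derivatives are everywhere (totally) differentiable; in particular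
  they all exist and are continuous.
\<close>

definition smooth :: "(real^'n::finite \<Rightarrow> complex) \<Rightarrow> bool" where
  "smooth f \<longleftrightarrow> (\<forall>is. fold partial_deriv is f differentiable_on UNIV)"

text \<open>
  The index type carries no order, so an enumeration of the coordinates is chosen; on smooth
  functions the result does not depend on it.
\<close>

definition coords :: "'n::finite list" where
  "coords = (SOME is. distinct is \<and> set is = UNIV)"

definition multi_deriv :: "('n::finite \<Rightarrow> nat) \<Rightarrow> (real^'n \<Rightarrow> complex) \<Rightarrow> real^'n \<Rightarrow> complex" where
  "multi_deriv \<alpha> f = fold (\<lambda>i. partial_deriv i ^^ \<alpha> i) coords f"

definition multi_order :: "('n::finite \<Rightarrow> nat) \<Rightarrow> nat" where
  "multi_order \<alpha> = (\<Sum>i\<in>UNIV. \<alpha> i)"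

definition fourier :: "(real^'n::finite \<Rightarrow> complex) \<Rightarrow> real^'n \<Rightarrow> complex" where
  "fourier f \<xi> = (LINT x|lborel. exp (- (\<i> * complex_of_real (x \<bullet> \<xi>))) * f x)"


section \<open>Weight functions\<close>

text \<open>Weights are total functions on \<open>real\<close>; their values at negative arguments are irrelevant.\<close>

definition nonquasianalytic_weight :: "(real \<Rightarrow> real) \<Rightarrow> bool" where
  "nonquasianalytic_weight \<omega> \<longleftrightarrow>
     continuous_on {0..} \<omega> \<and> mono_on {0..} \<omega> \<and> (\<forall>t\<ge>0. \<omega> t \<ge> 0) \<and>
     (\<exists>K\<ge>1. \<forall>t\<ge>0. \<omega> (2 * t) \<le> K * (1 + \<omega> t)) \<and>
     set_integrable lborel {1..} (\<lambda>t. \<omega> t / (1 + t^2)) \<and>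
     (\<exists>a b. b > 0 \<and> (\<forall>t\<ge>0. \<omega> t \<ge> a + b * ln (1 + t))) \<and>
     convex_on UNIV (\<lambda>t. \<omega> (exp t)) \<and>
     (\<forall>t\<in>{0..1}. \<omega> t = 0)"

definition young_conj :: "(real \<Rightarrow> real) \<Rightarrow> real \<Rightarrow> ereal" where
  "young_conj \<omega> s = (SUP t\<in>{0..}. ereal (s * t - \<omega> (exp t)))"

definition exp_ext :: "ereal \<Rightarrow> ennreal" where
  "exp_ext u = (case u of ereal r \<Rightarrow> ennreal (exp r) | PInfty \<Rightarrow> \<infinity> | MInfty \<Rightarrow> 0)"


section \<open>The spaces \<open>S\<^sub>\<omega>\<close>, \<open>S'\<^sub>\<omega>\<close> and \<open>O\<^sub>M\<^sub>,\<^sub>\<omega>\<close>\<close>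

definition S_omega :: "(real \<Rightarrow> real) \<Rightarrow> (real^'n::finite \<Rightarrow> complex) set" where
  "S_omega \<omega> = {f. integrable lborel f \<and> smooth f \<and> smooth (fourier f) \<and>
     (\<forall>l>0. \<forall>\<alpha>.
        bdd_above (range (\<lambda>x. exp (l * \<omega> (norm x)) * norm (multi_deriv \<alpha> f x))) \<and>
        bdd_above (range (\<lambda>x. exp (l * \<omega> (norm x)) * norm (multi_deriv \<alpha> (fourier f) x))))}"

definition q_norm :: "(real \<Rightarrow> real) \<Rightarrow> nat \<Rightarrow> nat \<Rightarrow> (real^'n::finite \<Rightarrow> complex) \<Rightarrow> ennreal" where
  "q_norm \<omega> m n f = (SUP \<alpha>.
     (SUP x. ennreal (exp (real n * \<omega> (norm x)) * norm (multi_deriv \<alpha> f x))) *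
     exp_ext (- (ereal (real m) * young_conj \<omega> (real (multi_order \<alpha>) / real m))))"

definition q_norms :: "(real \<Rightarrow> real) \<Rightarrow> ((real^'n::finite \<Rightarrow> complex) \<Rightarrow> ennreal) set" where
  "q_norms \<omega> = {q_norm \<omega> m n | m n. m \<ge> 1 \<and> n \<ge> 1}"

definition S_dual_topology ::
    "(real \<Rightarrow> real) \<Rightarrow> ((real^'n::finite \<Rightarrow> complex) \<Rightarrow> complex) topology" where
  "S_dual_topology \<omega> = strong_dual_topology (S_omega \<omega>) (q_norms \<omega>)"

definition r_norm :: "(real \<Rightarrow> real) \<Rightarrow> nat \<Rightarrow> nat \<Rightarrow> (real^'n::finite \<Rightarrow> complex) \<Rightarrow> ennreal" where
  "r_norm \<omega> m n f = (SUP \<alpha>. SUP x. ennreal (norm (multi_deriv \<alpha> f x)) *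
     exp_ext (ereal (- (real n * \<omega> (norm x))) -
              ereal (real m) * young_conj \<omega> (real (multi_order \<alpha>) / real m)))"

definition O_step :: "(real \<Rightarrow> real) \<Rightarrow> nat \<Rightarrow> nat \<Rightarrow> (real^'n::finite \<Rightarrow> complex) set" where
  "O_step \<omega> m n = {f. smooth f \<and> r_norm \<omega> m n f < \<infinity>}"

text \<open>By construction the underlying set is \<open>(\<Inter>m\<in>{1..}. \<Union>n\<in>{1..}. O_step \<omega> m n)\<close>.\<close>

definition O_M_topology :: "(real \<Rightarrow> real) \<Rightarrow> (real^'n::finite \<Rightarrow> complex) topology" where
  "O_M_topology \<omega> = projective_limit_topology {1..}
     (\<lambda>m. inductive_limit_topology {1..}
        (\<lambda>n. seminorm_topology (O_step \<omega> m n) {r_norm \<omega> m n}))"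

definition mult_dual ::
    "(real \<Rightarrow> real) \<Rightarrow> (real^'n::finite \<Rightarrow> complex) \<Rightarrow> ((real^'n \<Rightarrow> complex) \<Rightarrow> complex) \<Rightarrow>
     ((real^'n \<Rightarrow> complex) \<Rightarrow> complex)" where
  "mult_dual \<omega> f T = (\<lambda>g. if g \<in> S_omega \<omega> then T (\<lambda>x. f x * g x) else 0)"

end

theory Submission
  imports Defs "HOL-Complex_Analysis.Cauchy_Integral_Formula" "HOL-Probability.Characteristic_Functions"
begin

text \<open>
  Joint continuity at the origin would make \<open>U G\<close> bounded in \<open>S\<^sub>\<omega>\<close> for the Gaussian \<open>G\<close> and some
  neighbourhood \<open>U\<close> of zero in \<open>O\<^sub>M\<^sub>,\<^sub>\<omega>\<close>.  Such a \<open>U\<close> only controls the seminorms \<open>r\<^sub>l\<^sub>,\<^sub>1\<close> with \<open>l \<le> m\<close>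
  for a fixed \<open>m\<close>, so it contains all plane waves \<open>exp (\<i> \<xi> x\<^sub>1)\<close> scaled by \<open>exp (- m \<omega> \<xi>)\<close>, up to a constant.
  Their products with \<open>G\<close> have a \<open>k\<close>-th derivative at \<open>0\<close> of modulus at least \<open>\<xi>\<^sup>k exp (- m \<omega> \<xi>)\<close>, whereas
  on a bounded set it is \<open>O(exp (M \<phi>\<^sup>* (k / M)))\<close> for every \<open>M\<close>.  Taking \<open>t = ln \<xi>\<close> large and
  \<open>k = \<lfloor>M s\<rfloor>\<close>, with \<open>s\<close> the slope of a supporting line of \<open>\<phi>\<close> at \<open>t\<close>, the first quantity exceeds the
  second by any factor once \<open>M\<close> is large compared with \<open>m\<close>.
\<close>

unbundle no fps_syntax

section \<open>Iterated partial derivatives\<close>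

lemma distinct_coords: "distinct (coords :: 'n::finite list)"
  and set_coords: "set (coords :: 'n::finite list) = UNIV"
proof -
  have "\<exists>is. distinct is \<and> set is = (UNIV :: 'n set)"
    using finite_distinct_list[of "UNIV :: 'n set"] by auto
  from someI_ex[OF this] show "distinct (coords :: 'n list)" "set (coords :: 'n list) = UNIV"
    unfolding coords_def by blast+
qed

text \<open>A multi-index spelled out as a list of coordinates, so that \<open>multi_deriv\<close>
  becomes one \<open>fold\<close> of \<open>partial_deriv\<close>, the form in which
  \<open>smooth\<close> is stated.\<close>

definition deriv_list :: "('n::finite \<Rightarrow> nat) \<Rightarrow> 'n list" where
  "deriv_list \<alpha> = concat (map (\<lambda>i. replicate (\<alpha> i) i) coords)"

lemma multi_deriv_eq_fold: "multi_deriv \<alpha> f = fold partial_deriv (deriv_list \<alpha>) f"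
proof -
  have funpow: "fold h (replicate n i) = (h i ^^ n)" for h :: "'n \<Rightarrow> 'b \<Rightarrow> 'b" and n i
    by (induction n) (auto simp: fun_eq_iff funpow_swap1)
  have "fold (\<lambda>i. partial_deriv i ^^ \<alpha> i) is f = fold partial_deriv (concat (map (\<lambda>i. replicate (\<alpha> i) i) is)) f" for "is"
    by (induction "is" arbitrary: f) (auto simp: funpow)
  then show ?thesis
    unfolding multi_deriv_def deriv_list_def by simp
qed

text \<open>Chain rule along the line through x in direction \<open>axis i 1\<close>: total
  differentiability makes the derivative exist, so the choice inside
  \<open>vector_derivative\<close> picks it.\<close>

lemma has_partial_deriv:
  assumes "f differentiable (at x)"
  shows "((\<lambda>t. f (x + t *\<^sub>R axis i 1)) has_vector_derivative partial_deriv i f x) (at 0)"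
proof -
  have "((\<lambda>t. x + t *\<^sub>R axis i 1) has_derivative (\<lambda>t. t *\<^sub>R axis i 1)) (at (0::real))"
    by (auto intro!: derivative_eq_intros)
  moreover obtain D where "(f has_derivative D) (at x)"
    using assms unfolding differentiable_def by blast
  ultimately have "((\<lambda>t. f (x + t *\<^sub>R axis i 1)) has_derivative (\<lambda>t. D (t *\<^sub>R axis i 1))) (at (0::real))"
    using has_derivative_compose[of "\<lambda>t. x + t *\<^sub>R axis i 1" _ 0 UNIV f D] by simp
  then have "(\<lambda>t. f (x + t *\<^sub>R axis i 1)) differentiable (at (0::real))"
    unfolding differentiable_def by blast
  then show ?thesis
    unfolding partial_deriv_def by (rule vector_derivative_works[THEN iffD1])
qed

lemma partial_deriv_lincomb:
  assumes "f differentiable (at x)" "g differentiable (at x)"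
  shows "partial_deriv i (\<lambda>x. a * f x + b * g x) x = a * partial_deriv i f x + b * partial_deriv i g x"
  unfolding partial_deriv_def[of i "\<lambda>x. a * f x + b * g x"]
  by (rule vector_derivative_at)
    (intro derivative_intros has_vector_derivative_mult_right has_partial_deriv assms)

lemma fold_partial_deriv_lincomb:
  assumes "smooth f" "smooth g"
  shows "fold partial_deriv is (\<lambda>x. a * f x + b * g x) =
    (\<lambda>x. a * fold partial_deriv is f x + b * fold partial_deriv is g x)"
\<comment> \<open>The last list entry is the outermost derivative, so induction from the end leaves
  \<open>f\<close> and \<open>g\<close> fixed.\<close>
proof (induction "is" rule: rev_induct)
  case (snoc i "is")
  have "fold partial_deriv is f differentiable (at x)" "fold partial_deriv is g differentiable (at x)" for x
    using assms unfolding smooth_def differentiable_on_def by auto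
  then show ?case
    using snoc by (auto simp: partial_deriv_lincomb)
qed simp

lemma smooth_lincomb:
  assumes "smooth f" "smooth g"
  shows "smooth (\<lambda>x. a * f x + b * g x)"
  unfolding smooth_def fold_partial_deriv_lincomb[OF assms]
  using assms unfolding smooth_def by (intro allI derivative_intros) auto

lemma multi_deriv_lincomb:
  assumes "smooth f" "smooth g"
  shows "multi_deriv \<alpha> (\<lambda>x. a * f x + b * g x) x = a * multi_deriv \<alpha> f x + b * multi_deriv \<alpha> g x"
  unfolding multi_deriv_eq_fold fold_partial_deriv_lincomb[OF assms] ..

lemma smooth_cmult: "smooth f \<Longrightarrow> smooth (\<lambda>x. c * f x)"
  using smooth_lincomb[of f f c 0] by simp

lemma multi_deriv_cmult: "smooth f \<Longrightarrow> multi_deriv \<alpha> (\<lambda>x. c * f x) x = c * multi_deriv \<alpha> f x"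
  using multi_deriv_lincomb[of f f \<alpha> c 0] by simp

section \<open>Products of functions of one coordinate each\<close>

definition tensor :: "('n::finite \<Rightarrow> nat \<Rightarrow> real \<Rightarrow> complex) \<Rightarrow> ('n \<Rightarrow> nat) \<Rightarrow> real^'n \<Rightarrow> complex" where
  "tensor U \<alpha> x = (\<Prod>j\<in>UNIV. U j (\<alpha> j) (x $ j))"

text \<open>Such a chain lists all derivatives of one factor. In \<open>tensor U \<alpha>\<close>
  the entry \<open>\<alpha> j\<close> tells how often the factor \<open>U j\<close> has been
  differentiated; Gaussians and plane waves are both of this form.\<close>

definition deriv_seq :: "(nat \<Rightarrow> real \<Rightarrow> complex) \<Rightarrow> bool" where
  "deriv_seq u \<longleftrightarrow> (\<forall>k t. (u k has_vector_derivative u (Suc k) t) (at t))"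

lemma tensor_differentiable:
  assumes "\<And>j. deriv_seq (U j)"
  shows "tensor U \<alpha> differentiable (at x)"
proof -
  have "\<exists>D. ((\<lambda>x. U j (\<alpha> j) (x $ j)) has_derivative D) (at x)" for j
  proof -
    have "(U j (\<alpha> j) has_derivative (\<lambda>h. h *\<^sub>R U j (Suc (\<alpha> j)) (x $ j))) (at (x $ j))"
      using assms unfolding deriv_seq_def has_vector_derivative_def by blast
    moreover have "((\<lambda>x. x $ j) has_derivative (\<lambda>x. x $ j)) (at x)"
      by (intro bounded_linear_imp_has_derivative bounded_linear_vec_nth)
    ultimately show ?thesis
      using has_derivative_compose[of "\<lambda>x. x $ j" _ x UNIV "U j (\<alpha> j)"] by blast
  qed
  then obtain D where "\<And>j. ((\<lambda>x. U j (\<alpha> j) (x $ j)) has_derivative D j) (at x)"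
    by metis
  then have "((\<lambda>x. \<Prod>j\<in>UNIV. U j (\<alpha> j) (x $ j)) has_derivative
      (\<lambda>y. \<Sum>i\<in>UNIV. D i y * (\<Prod>j\<in>UNIV - {i}. U j (\<alpha> j) (x $ j)))) (at x)"
    by (intro has_derivative_prod) auto
  then show ?thesis
    unfolding differentiable_def tensor_def[abs_def] by blast
qed

text \<open>Along the \<open>i\<close>-th axis only the \<open>i\<close>-th factor varies; the
  others form the constant \<open>?R\<close>.\<close>

lemma partial_deriv_tensor:
  fixes U :: "'n::finite \<Rightarrow> nat \<Rightarrow> real \<Rightarrow> complex"
  assumes "\<And>j. deriv_seq (U j)"
  shows "partial_deriv i (tensor U \<alpha>) = tensor U (\<alpha>(i := Suc (\<alpha> i)))"
proof
  fix x :: "real^'n"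
  let ?R = "\<Prod>j\<in>UNIV - {i}. U j (\<alpha> j) (x $ j)"
  have "tensor U \<alpha> (x + t *\<^sub>R axis i 1) = U i (\<alpha> i) (x $ i + t) * ?R" for t
    unfolding tensor_def by (subst prod.remove[of _ i]) (auto intro!: prod.cong simp: axis_def)
  moreover have "((\<lambda>t. U i (\<alpha> i) (x $ i + t)) has_vector_derivative U i (Suc (\<alpha> i)) (x $ i)) (at 0)"
  proof -
    have "((+) (x $ i) has_vector_derivative 1) (at 0)"
      unfolding has_real_derivative_iff_has_vector_derivative[symmetric]
      by (auto intro!: derivative_eq_intros)
    then show ?thesis
      using assms vector_diff_chain_at[of "\<lambda>t. x $ i + t" 1 0 "U i (\<alpha> i)"]
      unfolding deriv_seq_def o_def by auto
  qed
  ultimately have "((\<lambda>t. tensor U \<alpha> (x + t *\<^sub>R axis i 1)) has_vector_derivative U i (Suc (\<alpha> i)) (x $ i) * ?R) (at 0)"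
    by (auto intro: has_vector_derivative_mult_left)
  then have "partial_deriv i (tensor U \<alpha>) x = U i (Suc (\<alpha> i)) (x $ i) * ?R"
    unfolding partial_deriv_def by (rule vector_derivative_at)
  also have "\<dots> = tensor U (\<alpha>(i := Suc (\<alpha> i))) x"
    unfolding tensor_def by (subst (2) prod.remove[of _ i]) (auto intro!: prod.cong)
  finally show "partial_deriv i (tensor U \<alpha>) x = tensor U (\<alpha>(i := Suc (\<alpha> i))) x" .
qed

text \<open>Each occurrence of a coordinate in the list raises the matching entry of the multi-index
  by one, so the result depends on the list only through its counts and not on the order chosen in
  \<open>coords\<close>.\<close>

lemma fold_partial_deriv_tensor:
  assumes "\<And>j. deriv_seq (U j)"
  shows "fold partial_deriv is (tensor U \<alpha>) = tensor U (\<lambda>i. \<alpha> i + count_list is i)"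
proof (induction "is" arbitrary: \<alpha>)
  case (Cons i "is")
  have "(\<lambda>j. (\<alpha>(i := Suc (\<alpha> i))) j + count_list is j) = (\<lambda>j. \<alpha> j + count_list (i # is) j)"
    by auto
  then show ?case
    using Cons.IH[of "\<alpha>(i := Suc (\<alpha> i))"]
    by (simp add: partial_deriv_tensor[OF assms] del: fun_upd_apply count_list.simps)
qed simp

lemma smooth_tensor:
  assumes "\<And>j. deriv_seq (U j)"
  shows "smooth (tensor U \<alpha>)"
  unfolding smooth_def fold_partial_deriv_tensor[OF assms] differentiable_on_def
  using tensor_differentiable[OF assms] by (auto intro: differentiable_at_withinI)

lemma count_list_deriv_list:
  fixes i :: "'n::finite"
  shows "count_list (deriv_list \<alpha>) i = \<alpha> i"
proof -
  have rep: "count_list (replicate n j) i = (if i = j then n else 0)" for n and j :: 'n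
    by (induction n) auto
  have "count_list (concat (map (\<lambda>i. replicate (\<alpha> i) i) is)) i = (if i \<in> set is then \<alpha> i else 0)"
    if "distinct is" for "is"
    using that by (induction "is") (auto simp: rep count_list_append)
  then show ?thesis
    unfolding deriv_list_def by (simp add: distinct_coords set_coords)
qed

lemma multi_deriv_tensor:
  assumes "\<And>j. deriv_seq (U j)"
  shows "multi_deriv \<alpha> (tensor U (\<lambda>_. 0)) = tensor U \<alpha>"
  unfolding multi_deriv_eq_fold fold_partial_deriv_tensor[OF assms] by (simp add: count_list_deriv_list)

section \<open>Topologies of the function spaces\<close>

lemma exp_ext_mono: "u \<le> v \<Longrightarrow> exp_ext u \<le> exp_ext v"
  unfolding exp_ext_def by (cases u; cases v) (auto intro: ennreal_leI)

section \<open>Linear structure of \<open>S_omega\<close> and of the spaces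
  \<open>O_step\<close>\<close>

lemma bdd_above_lincomb:
  fixes f g :: "'a \<Rightarrow> complex"
  assumes f: "bdd_above (range (\<lambda>x. w x * norm (f x)))" and g: "bdd_above (range (\<lambda>x. w x * norm (g x)))"
    and w: "\<And>x. w x \<ge> 0"
  shows "bdd_above (range (\<lambda>x. w x * norm (a * f x + b * g x)))"
proof -
  obtain A B where A: "\<And>x. w x * norm (f x) \<le> A" and B: "\<And>x. w x * norm (g x) \<le> B"
    using f g unfolding bdd_above_def by auto
  have "w x * norm (a * f x + b * g x) \<le> norm a * A + norm b * B" for x
  proof -
    have "w x * norm (a * f x + b * g x) \<le> w x * (norm a * norm (f x) + norm b * norm (g x))"
      using w[of x] norm_triangle_ineq[of "a * f x" "b * g x"]
      by (intro mult_left_mono) (auto simp: norm_mult)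
    also have "\<dots> = norm a * (w x * norm (f x)) + norm b * (w x * norm (g x))"
      by (simp add: algebra_simps)
    also have "\<dots> \<le> norm a * A + norm b * B"
      using A B by (intro add_mono mult_left_mono) auto
    finally show ?thesis .
  qed
  then show ?thesis
    by (auto intro!: bdd_aboveI2)
qed

lemma fourier_integrable:
  assumes "integrable lborel f"
  shows "integrable lborel (\<lambda>x. exp (- (\<i> * complex_of_real (x \<bullet> \<xi>))) * f x)"
proof (rule Bochner_Integration.integrable_bound[OF assms])
  have [measurable]: "f \<in> borel_measurable lborel"
    using assms by (rule borel_measurable_integrable)
  show "(\<lambda>x. exp (- (\<i> * complex_of_real (x \<bullet> \<xi>))) * f x) \<in> borel_measurable lborel"
    by measurable
qed (auto simp: norm_mult)

lemma fourier_lincomb: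
  assumes "integrable lborel f" "integrable lborel g"
  shows "fourier (\<lambda>x. a * f x + b * g x) = (\<lambda>\<xi>. a * fourier f \<xi> + b * fourier g \<xi>)"
proof
  fix \<xi>
  have "fourier (\<lambda>x. a * f x + b * g x) \<xi> =
    (LINT x|lborel. a * (exp (- (\<i> * complex_of_real (x \<bullet> \<xi>))) * f x) + b * (exp (- (\<i> * complex_of_real (x \<bullet> \<xi>))) * g x))"
    unfolding fourier_def by (simp add: algebra_simps)
  also have "\<dots> = a * fourier f \<xi> + b * fourier g \<xi>"
    unfolding fourier_def using fourier_integrable[OF assms(1)] fourier_integrable[OF assms(2)] by simp
  finally show "fourier (\<lambda>x. a * f x + b * g x) \<xi> = a * fourier f \<xi> + b * fourier g \<xi>" .
qed

lemma S_omega_lincomb: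
  assumes f: "f \<in> S_omega \<omega>" and g: "g \<in> S_omega \<omega>"
  shows "(\<lambda>x. a * f x + b * g x) \<in> S_omega \<omega>"
proof -
  have "integrable lborel f" "integrable lborel g" "smooth f" "smooth g"
    "smooth (fourier f)" "smooth (fourier g)"
    using f g unfolding S_omega_def by auto
  moreover have "bdd_above (range (\<lambda>x. exp (l * \<omega> (norm x)) * norm (a * multi_deriv \<alpha> f x + b * multi_deriv \<alpha> g x)))"
    "bdd_above (range (\<lambda>x. exp (l * \<omega> (norm x)) * norm (a * multi_deriv \<alpha> (fourier f) x + b * multi_deriv \<alpha> (fourier g) x)))"
    if "l > 0" for l \<alpha>
    using f g that unfolding S_omega_def by (auto intro!: bdd_above_lincomb)
  ultimately show ?thesis
    unfolding S_omega_def by (auto simp: fourier_lincomb multi_deriv_lincomb smooth_lincomb)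
qed

lemma S_omega_cmult: "f \<in> S_omega \<omega> \<Longrightarrow> (\<lambda>x. c * f x) \<in> S_omega \<omega>"
  using S_omega_lincomb[of f \<omega> f c 0] by simp

lemma r_norm_lincomb:
  assumes "smooth f" "smooth g"
  shows "r_norm \<omega> m n (\<lambda>x. a * f x + b * g x) \<le> ennreal (norm a) * r_norm \<omega> m n f + ennreal (norm b) * r_norm \<omega> m n g"
proof -
  define w :: "('a \<Rightarrow> nat) \<Rightarrow> real^'a \<Rightarrow> ennreal" where
    "w \<alpha> x = exp_ext (ereal (- (real n * \<omega> (norm x))) -
              ereal (real m) * young_conj \<omega> (real (multi_order \<alpha>) / real m))" for \<alpha> x
  have r: "r_norm \<omega> m n f = (SUP \<alpha>. SUP x. ennreal (norm (multi_deriv \<alpha> f x)) * w \<alpha> x)" for f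
    unfolding r_norm_def w_def ..
  have le: "ennreal (norm (multi_deriv \<alpha> f x)) * w \<alpha> x \<le> r_norm \<omega> m n f" for f \<alpha> x
    unfolding r by (rule SUP_upper2[where i = \<alpha>], simp, rule SUP_upper2[where i = x]) auto
  have "ennreal (norm (a * multi_deriv \<alpha> f x + b * multi_deriv \<alpha> g x)) * w \<alpha> x
      \<le> ennreal (norm a) * r_norm \<omega> m n f + ennreal (norm b) * r_norm \<omega> m n g" for \<alpha> x
  proof -
    have "ennreal (norm (a * multi_deriv \<alpha> f x + b * multi_deriv \<alpha> g x)) \<le>
        ennreal (norm a * norm (multi_deriv \<alpha> f x) + norm b * norm (multi_deriv \<alpha> g x))"
      using norm_triangle_ineq[of "a * multi_deriv \<alpha> f x" "b * multi_deriv \<alpha> g x"]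
      by (intro ennreal_leI) (auto simp: norm_mult)
    also have "\<dots> = ennreal (norm a) * ennreal (norm (multi_deriv \<alpha> f x)) + ennreal (norm b) * ennreal (norm (multi_deriv \<alpha> g x))"
      by (simp add: ennreal_mult)
    finally have "ennreal (norm (a * multi_deriv \<alpha> f x + b * multi_deriv \<alpha> g x)) * w \<alpha> x \<le>
      (ennreal (norm a) * ennreal (norm (multi_deriv \<alpha> f x)) + ennreal (norm b) * ennreal (norm (multi_deriv \<alpha> g x))) * w \<alpha> x"
      by (rule mult_right_mono) simp
    also have "\<dots> = ennreal (norm a) * (ennreal (norm (multi_deriv \<alpha> f x)) * w \<alpha> x) + ennreal (norm b) * (ennreal (norm (multi_deriv \<alpha> g x)) * w \<alpha> x)"
      by (simp add: distrib_right mult.assoc)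
    also have "\<dots> \<le> ennreal (norm a) * r_norm \<omega> m n f + ennreal (norm b) * r_norm \<omega> m n g"
      by (intro add_mono mult_left_mono le) auto
    finally show ?thesis .
  qed
  then show ?thesis
    unfolding r[of "\<lambda>x. a * f x + b * g x"] multi_deriv_lincomb[OF assms] by (intro SUP_least)
qed

lemma O_step_lincomb:
  assumes "f \<in> O_step \<omega> m n" "g \<in> O_step \<omega> m n"
  shows "(\<lambda>x. a * f x + b * g x) \<in> O_step \<omega> m n"
proof -
  have "r_norm \<omega> m n (\<lambda>x. a * f x + b * g x) \<le> ennreal (norm a) * r_norm \<omega> m n f + ennreal (norm b) * r_norm \<omega> m n g"
    using assms by (intro r_norm_lincomb) (auto simp: O_step_def)
  also have "\<dots> < \<infinity>"
    using assms by (auto simp: O_step_def ennreal_mult_less_top)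
  finally show ?thesis
    using assms by (auto simp: O_step_def smooth_lincomb)
qed

text \<open>Raising n shrinks the weight exp(-n \<omega>) because \<omega> is nonnegative, so the
  norms decrease and the steps increase.\<close>

lemma O_step_mono:
  assumes \<omega>: "\<forall>t\<ge>0. \<omega> t \<ge> 0" and "n \<le> n'"
  shows "(O_step \<omega> m n :: (real^'a::finite \<Rightarrow> complex) set) \<subseteq> O_step \<omega> m n'"
proof -
  have "r_norm \<omega> m n' f \<le> r_norm \<omega> m n f" for f :: "real^'a \<Rightarrow> complex"
    unfolding r_norm_def
  proof (rule SUP_mono', rule SUP_mono', rule mult_left_mono, rule exp_ext_mono, rule ereal_minus_mono)
    fix x :: "real^'a"
    have "real n * \<omega> (norm x) \<le> real n' * \<omega> (norm x)"
      using assms by (intro mult_right_mono) simp_all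
    then show "ereal (- (real n' * \<omega> (norm x))) \<le> ereal (- (real n * \<omega> (norm x)))"
      by simp
  qed (rule order_refl zero_le)+
  then show "O_step \<omega> m n \<subseteq> (O_step \<omega> m n' :: (real^'a \<Rightarrow> complex) set)"
    unfolding O_step_def by (auto intro: le_less_trans)
qed

text \<open>Two functions from different steps lie in the common step \<open>max n n'\<close>, and
  each step is a vector space.\<close>

lemma O_union_lincomb:
  assumes \<omega>: "\<forall>t\<ge>0. \<omega> t \<ge> 0"
    and "f \<in> (\<Union>n\<in>{1..}. O_step \<omega> m n)" "g \<in> (\<Union>n\<in>{1..}. O_step \<omega> m n)"
  shows "(\<lambda>x. a * f x + b * g x) \<in> (\<Union>n\<in>{1..}. O_step \<omega> m n)"
proof -
  obtain n n' where "n \<ge> 1" "f \<in> O_step \<omega> m n" "n' \<ge> 1" "g \<in> O_step \<omega> m n'"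
    using assms(2,3) by auto
  then have "f \<in> O_step \<omega> m (max n n')" "g \<in> O_step \<omega> m (max n n')"
    using O_step_mono[OF \<omega>] by (meson max.cobounded1 max.cobounded2 subsetD)+
  then show ?thesis
    using O_step_lincomb \<open>n \<ge> 1\<close> by (intro UN_I[of "max n n'"]) auto
qed

section \<open>Inductive and projective limit topologies\<close>

lemma openin_seminorm_topology_empty:
  "openin (seminorm_topology V {}) U \<longleftrightarrow> U = {} \<or> U = V"
  unfolding openin_seminorm_topology by (auto intro: exI[of _ "1::real"])

lemma continuous_map_into_indiscrete:
  assumes "\<And>x. x \<in> topspace X \<Longrightarrow> f x \<in> V"
  shows "continuous_map X (seminorm_topology V {}) f"
proof -
  have "{x \<in> topspace X. f x \<in> V} = topspace X"
    using assms by auto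
  then show ?thesis
    using assms unfolding continuous_map_def
    by (auto simp: openin_seminorm_topology_empty topspace_seminorm_topology)
qed

text \<open>With no seminorms the topology is indiscrete. It serves as a locally convex topology
  into which every inclusion is continuous.\<close>

lemma locally_convex_indiscrete:
  assumes V: "\<And>f g a b. f \<in> V \<Longrightarrow> g \<in> V \<Longrightarrow> (\<lambda>x. a * f x + b * g x) \<in> V"
  shows "locally_convex_topology_on V (seminorm_topology V {})"
proof -
  have "(\<lambda>x. f x + g x) \<in> V" "(\<lambda>x. c * f x) \<in> V" if "f \<in> V" "g \<in> V" for f g c
    using that V[of f g 1 1] V[of f f c 0] by auto
  then show ?thesis
    unfolding locally_convex_topology_on_def
    by (intro conjI continuous_map_into_indiscrete)
      (auto simp: topspace_seminorm_topology openin_seminorm_topology_empty intro!: V)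
qed

text \<open>A generated topology covers only the union of its generators, so some admissible
  topology must be exhibited in which the whole space is open; the indiscrete one is
  admissible.\<close>

lemma topspace_inductive_limit:
  assumes "\<And>f g a b. f \<in> (\<Union>i\<in>I. topspace (X i)) \<Longrightarrow> g \<in> (\<Union>i\<in>I. topspace (X i)) \<Longrightarrow>
    (\<lambda>x. a * f x + b * g x) \<in> (\<Union>i\<in>I. topspace (X i))"
  shows "topspace (inductive_limit_topology I X) = (\<Union>i\<in>I. topspace (X i))" (is "_ = ?V")
proof
  show "topspace (inductive_limit_topology I X) \<subseteq> ?V"
    unfolding inductive_limit_topology_def topology_generated_by_topspace
      locally_convex_topology_on_def using openin_subset by fastforce
  have "locally_convex_topology_on ?V (seminorm_topology ?V {})"
    using assms by (rule locally_convex_indiscrete)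
  moreover have "\<forall>i\<in>I. continuous_map (X i) (seminorm_topology ?V {}) (\<lambda>f. f)"
    by (intro ballI continuous_map_into_indiscrete) auto
  moreover have "openin (seminorm_topology ?V {}) ?V"
    by (simp add: openin_seminorm_topology_empty)
  ultimately show "?V \<subseteq> topspace (inductive_limit_topology I X)"
    unfolding inductive_limit_topology_def topology_generated_by_topspace by blast
qed

text \<open>Each generator is open in a topology that receives \<open>X i\<close> continuously, so
  its trace on \<open>X i\<close> is open, and finite intersections and unions preserve this. It
  expresses the continuity of the inclusion of \<open>X i\<close> into the limit.\<close>

lemma openin_inductive_limit:
  assumes "openin (inductive_limit_topology I X) U" "i \<in> I"
  shows "openin (X i) (topspace (X i) \<inter> U)"
proof -
  have "generate_topology_on {U. \<exists>\<tau>. locally_convex_topology_on (\<Union>i\<in>I. topspace (X i)) \<tau> \<and>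
             (\<forall>i\<in>I. continuous_map (X i) \<tau> (\<lambda>f. f)) \<and> openin \<tau> U} U"
    using assms(1) unfolding inductive_limit_topology_def by (rule openin_topology_generated_by)
  then show ?thesis
  proof (induction rule: generate_topology_on.induct)
    case (Int A B)
    have "topspace (X i) \<inter> (A \<inter> B) = (topspace (X i) \<inter> A) \<inter> (topspace (X i) \<inter> B)"
      by blast
    then show ?case
      using Int.IH by (simp only: openin_Int)
  next
    case (UN K)
    then have "openin (X i) (\<Union>A\<in>K. topspace (X i) \<inter> A)"
      by (intro openin_Union) blast
    then show ?case
      by (simp only: Int_Union)
  next
    case (Basis s)
    then obtain \<tau> where "continuous_map (X i) \<tau> (\<lambda>f. f)" "openin \<tau> s"
      using assms(2) by auto
    then show ?case
      unfolding continuous_map_def by (simp add: Int_def)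
  qed simp
qed

lemma topspace_O_ind:
  assumes "\<forall>t\<ge>0. \<omega> t \<ge> 0"
  shows "topspace (inductive_limit_topology {1..} (\<lambda>n. seminorm_topology (O_step \<omega> m n) {r_norm \<omega> m n}))
    = (\<Union>n\<in>{1..}. O_step \<omega> m n)"
proof -
  have "\<And>f g a b. f \<in> (\<Union>n\<in>{1..}. O_step \<omega> m n) \<Longrightarrow> g \<in> (\<Union>n\<in>{1..}. O_step \<omega> m n) \<Longrightarrow>
      (\<lambda>x. a * f x + b * g x) \<in> (\<Union>n\<in>{1..}. O_step \<omega> m n)"
    by (rule O_union_lincomb[OF assms])
  then show ?thesis
    using topspace_inductive_limit[where I = "{1..}" and X = "\<lambda>n. seminorm_topology (O_step \<omega> m n) {r_norm \<omega> m n}"]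
    unfolding topspace_seminorm_topology by blast
qed

text \<open>The whole intersection is itself a generator, namely the trace of
  \<open>topspace (X j)\<close>.\<close>

lemma topspace_projective_limit:
  assumes "j \<in> I"
  shows "topspace (projective_limit_topology I X) = (\<Inter>i\<in>I. topspace (X i))" (is "_ = ?V")
proof -
  have "?V = topspace (X j) \<inter> ?V"
    using assms by auto
  then have "?V \<in> {U \<inter> ?V |U. \<exists>i\<in>I. openin (X i) U}"
    using assms openin_topspace[of "X j"] by blast
  then show ?thesis
    unfolding projective_limit_topology_def topology_generated_by_topspace by blast
qed

lemma topspace_O_M:
  assumes "\<forall>t\<ge>0. \<omega> t \<ge> 0"
  shows "topspace (O_M_topology \<omega>) = (\<Inter>m\<in>{1..}. \<Union>n\<in>{1..}. O_step \<omega> m n)"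
proof -
  have "topspace (O_M_topology \<omega>) = (\<Inter>m\<in>{1..}. topspace (inductive_limit_topology {1..}
      (\<lambda>n. seminorm_topology (O_step \<omega> m n) {r_norm \<omega> m n})))"
    unfolding O_M_topology_def by (rule topspace_projective_limit[of 1]) simp
  then show ?thesis
    by (simp only: topspace_O_ind[OF assms])
qed

section \<open>Neighbourhoods of zero in \<open>O_M_topology\<close> and in the strong dual\<close>

lemma fold_partial_deriv_zero: "fold partial_deriv is (\<lambda>x. 0) = (\<lambda>x. 0)"
  by (induction "is") (auto simp: partial_deriv_def)

lemma zero_in_O_step: "(\<lambda>x. 0) \<in> O_step \<omega> m n"
  by (simp add: O_step_def r_norm_def smooth_def multi_deriv_eq_fold fold_partial_deriv_zero)

text \<open>A generator is open at a single level m, and its trace on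
  \<open>O_step \<omega> m 1\<close> contains a ball of \<open>r_norm \<omega> m 1\<close>. A finite
  intersection involves finitely many levels, whence the bound \<open>M\<close>.\<close>

lemma O_M_nbhd_zero:
  fixes \<omega> :: "real \<Rightarrow> real" and U :: "(real^'n::finite \<Rightarrow> complex) set"
  assumes \<omega>: "\<forall>t\<ge>0. \<omega> t \<ge> 0"
    and U: "openin (O_M_topology \<omega>) U" "(\<lambda>x. 0) \<in> U"
  shows "\<exists>M \<epsilon>. \<epsilon> > 0 \<and> (\<forall>f \<in> topspace (O_M_topology \<omega>).
    (\<forall>m\<in>{1..M}. r_norm \<omega> m 1 f < ennreal \<epsilon>) \<longrightarrow> f \<in> U)"
proof -
  let ?X = "\<lambda>m. inductive_limit_topology {1..} (\<lambda>n. seminorm_topology (O_step \<omega> m n) {r_norm \<omega> m n})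
    :: (real^'n \<Rightarrow> complex) topology"
  let ?I = "(\<Inter>i\<in>{1..}. topspace (?X i)) :: (real^'n \<Rightarrow> complex) set"
  have I: "topspace (O_M_topology \<omega>) = ?I"
    by (simp only: topspace_O_M[OF \<omega>] topspace_O_ind[OF \<omega>])
  have "generate_topology_on {U \<inter> ?I |U. \<exists>i\<in>{1..}. openin (?X i) U} U"
    using U(1) unfolding O_M_topology_def projective_limit_topology_def
    by (rule openin_topology_generated_by)
  \<comment> \<open>The condition on the zero function joins the induction claim, since the
    intermediate sets need it one by one.\<close>
  then have "(\<lambda>x. 0) \<in> U \<longrightarrow> ?thesis"
  proof (induction rule: generate_topology_on.induct)
    case (Int A B)
    show ?case
    proof
      assume "(\<lambda>x. 0) \<in> A \<inter> B"
      then have "(\<lambda>x. 0) \<in> A" "(\<lambda>x. 0) \<in> B"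
        by auto
      from Int.IH(1)[rule_format, OF this(1)] Int.IH(2)[rule_format, OF this(2)]
      obtain M \<epsilon> M' \<epsilon>' where A: "\<epsilon> > 0" "\<forall>f \<in> topspace (O_M_topology \<omega>).
          (\<forall>m\<in>{1..M}. r_norm \<omega> m 1 f < ennreal \<epsilon>) \<longrightarrow> f \<in> A"
        and B: "\<epsilon>' > 0" "\<forall>f \<in> topspace (O_M_topology \<omega>).
          (\<forall>m\<in>{1..M'}. r_norm \<omega> m 1 f < ennreal \<epsilon>') \<longrightarrow> f \<in> B"
        by (elim exE conjE) (rule that)
      have le: "ennreal (min \<epsilon> \<epsilon>') \<le> ennreal \<epsilon>" "ennreal (min \<epsilon> \<epsilon>') \<le> ennreal \<epsilon>'"
        by (auto intro: ennreal_leI)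
      have "f \<in> A \<inter> B" if f: "f \<in> topspace (O_M_topology \<omega>)"
        "\<forall>m\<in>{1..max M M'}. r_norm \<omega> m 1 f < ennreal (min \<epsilon> \<epsilon>')" for f
      proof
        show "f \<in> A"
          using f le(1) by (intro A(2)[rule_format]) (auto intro: less_le_trans)
        show "f \<in> B"
          using f le(2) by (intro B(2)[rule_format]) (auto intro: less_le_trans)
      qed
      then show "\<exists>M \<epsilon>. \<epsilon> > 0 \<and> (\<forall>f \<in> topspace (O_M_topology \<omega>).
          (\<forall>m\<in>{1..M}. r_norm \<omega> m 1 f < ennreal \<epsilon>) \<longrightarrow> f \<in> A \<inter> B)"
        using A(1) B(1) by (intro exI[of _ "max M M'"] exI[of _ "min \<epsilon> \<epsilon>'"]) auto
    qed
  next
    case (UN K)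
    show ?case
    proof
      assume "(\<lambda>x. 0) \<in> \<Union>K"
      then obtain A where A: "A \<in> K" "(\<lambda>x. 0) \<in> A" by auto
      with UN.IH[OF A(1)] show "\<exists>M \<epsilon>. \<epsilon> > 0 \<and> (\<forall>f \<in> topspace (O_M_topology \<omega>).
          (\<forall>m\<in>{1..M}. r_norm \<omega> m 1 f < ennreal \<epsilon>) \<longrightarrow> f \<in> \<Union>K)"
        by (meson UnionI)
    qed
  next
    case (Basis s)
    then obtain V m where V: "s = V \<inter> ?I" "m \<ge> 1" "openin (?X m) V" by auto
    show ?case
    proof
      assume "(\<lambda>x. 0) \<in> s"
      then have z: "(\<lambda>x. 0) \<in> O_step \<omega> m 1 \<inter> V"
        using V zero_in_O_step by auto
      have "openin (seminorm_topology (O_step \<omega> m 1) {r_norm \<omega> m 1}) (O_step \<omega> m 1 \<inter> V)"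
        using openin_inductive_limit[OF V(3), of 1] by (simp add: topspace_seminorm_topology)
      \<comment> \<open>The ball is centred at the zero function; \<open>diff_zero\<close> removes
        the subtraction of the centre.\<close>
      from bspec[OF conjunct2[OF this[unfolded openin_seminorm_topology]] z]
      obtain F e where F: "F \<subseteq> {r_norm \<omega> m 1}" "e > 0"
        "\<forall>v\<in>O_step \<omega> m 1. (\<forall>p\<in>F. p v < ennreal e) \<longrightarrow> v \<in> V"
        unfolding diff_zero by blast
      have "f \<in> s" if f: "f \<in> topspace (O_M_topology \<omega>)" "\<forall>m\<in>{1..m}. r_norm \<omega> m 1 f < ennreal e" for f
      proof -
        have less: "r_norm \<omega> m 1 f < ennreal e"
          using f(2) V(2) by auto
        have "f \<in> (\<Union>n\<in>{1..}. O_step \<omega> m n)"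
          using f(1) V(2) unfolding topspace_O_M[OF \<omega>] by simp
        then have "smooth f"
          unfolding O_step_def by auto
        \<comment> \<open>So far \<open>f\<close> lies in some step of the union; the small norm
          places it in the first one.\<close>
        then have "f \<in> O_step \<omega> m 1"
          using less unfolding O_step_def by (auto intro: less_trans)
        then have "f \<in> V"
          using less F(1) by (intro F(3)[rule_format]) auto
        then show ?thesis
          using f(1) I V(1) by simp
      qed
      then show "\<exists>M \<epsilon>. \<epsilon> > 0 \<and> (\<forall>f \<in> topspace (O_M_topology \<omega>).
          (\<forall>m\<in>{1..M}. r_norm \<omega> m 1 f < ennreal \<epsilon>) \<longrightarrow> f \<in> s)"
        using F(2) by blast
    qed
  qed simp
  then show ?thesis
    using U(2) by simp
qed

text \<open>Equicontinuous sets are bounded in the strong dual: a basic neighbourhood comes from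
  finitely many bounded sets, \<open>q\<close> has a finite supremum on each, and a small multiple
  of \<open>q\<close> is then small on all of them.\<close>

lemma strong_dual_nbhd_zero:
  assumes W: "openin (strong_dual_topology V P) W" "(\<lambda>h. 0) \<in> W" and q: "q \<in> P"
  shows "\<exists>c>0. \<forall>T \<in> dual_space V P. (\<forall>h\<in>V. ennreal (norm (T h)) \<le> ennreal c * q h) \<longrightarrow> T \<in> W"
proof -
  from bspec[OF conjunct2[OF W(1)[unfolded strong_dual_topology_def openin_seminorm_topology]] W(2)]
  obtain F e where F: "finite F" "e > 0"
    "F \<subseteq> {(\<lambda>T. SUP g\<in>B. ennreal (norm (T g))) | B. seminorm_bounded V P B}"
    "\<forall>T\<in>dual_space V P. (\<forall>p\<in>F. p T < ennreal e) \<longrightarrow> T \<in> W"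
    unfolding diff_zero by blast
  \<comment> \<open>\<open>C\<close> is the supremum of \<open>q\<close> over the bounded set behind
    \<open>p\<close>. It depends neither on \<open>c\<close> nor on \<open>T\<close>, so
    \<open>c\<close> can be fixed afterwards.\<close>
  have "\<exists>C\<ge>0. \<forall>c\<ge>0. \<forall>T. (\<forall>h\<in>V. ennreal (norm (T h)) \<le> ennreal c * q h) \<longrightarrow> p T \<le> ennreal (c * C)"
    if "p \<in> F" for p
  proof -
    obtain B where B: "p = (\<lambda>T. SUP g\<in>B. ennreal (norm (T g)))" "seminorm_bounded V P B"
      using F(3) \<open>p \<in> F\<close> by auto
    define C where "C = enn2real (SUP g\<in>B. q g)"
    have C: "(SUP g\<in>B. q g) = ennreal C"
      using B(2) q unfolding seminorm_bounded_def C_def by (simp add: less_top)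
    have "p T \<le> ennreal (c * C)"
      if "c \<ge> 0" "\<forall>h\<in>V. ennreal (norm (T h)) \<le> ennreal c * q h" for c T
      unfolding B(1)
    proof (rule SUP_least)
      fix g assume "g \<in> B"
      then have "ennreal (norm (T g)) \<le> ennreal c * q g"
        using that(2) B(2) unfolding seminorm_bounded_def by auto
      also have "\<dots> \<le> ennreal c * ennreal C"
        unfolding C[symmetric] using \<open>g \<in> B\<close> by (intro mult_left_mono SUP_upper) auto
      finally show "ennreal (norm (T g)) \<le> ennreal (c * C)"
        using that(1) by (simp add: ennreal_mult C_def)
    qed
    then show ?thesis
      by (intro exI[of _ C]) (auto simp: C_def)
  qed
  then obtain C where C: "\<And>p. p \<in> F \<Longrightarrow> C p \<ge> 0"
    "\<And>p c T. p \<in> F \<Longrightarrow> c \<ge> 0 \<Longrightarrow> \<forall>h\<in>V. ennreal (norm (T h)) \<le> ennreal c * q h \<Longrightarrow> p T \<le> ennreal (c * C p)"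
    by metis
  define D where "D = sum C F"
  have D: "C p \<le> D" if "p \<in> F" for p
    unfolding D_def using that F(1) C(1) by (intro member_le_sum) auto
  have D0: "D \<ge> 0"
    unfolding D_def using C(1) by (rule sum_nonneg)
  \<comment> \<open>The denominator stays positive for D = 0, and c D is strictly below e.\<close>
  define c where "c = e / (2 * (D + 1))"
  have c: "c > 0"
    unfolding c_def using F(2) D0 by simp
  have "e * D < e * (2 * (D + 1))"
    using F(2) D0 by (intro mult_strict_left_mono) auto
  then have cD: "c * D < e"
    unfolding c_def using D0 by (simp add: pos_divide_less_eq)
  have "T \<in> W" if T: "T \<in> dual_space V P" "\<forall>h\<in>V. ennreal (norm (T h)) \<le> ennreal c * q h" for T
  proof (rule F(4)[rule_format, OF T(1)])
    fix p assume "p \<in> F"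
    then have "p T \<le> ennreal (c * C p)"
      using C(2) T(2) c by auto
    also have "\<dots> < ennreal e"
      using F(2) le_less_trans[OF mult_left_mono[OF D[OF \<open>p \<in> F\<close>] less_imp_le[OF c]] cD]
      by (rule ennreal_lessI)
    finally show "p T < ennreal e" .
  qed
  then show ?thesis
    using c by auto
qed

section \<open>Weights and the one-dimensional Gaussian\<close>

lemma weight_nonneg: "nonquasianalytic_weight \<omega> \<Longrightarrow> \<forall>t\<ge>0. \<omega> t \<ge> 0"
  unfolding nonquasianalytic_weight_def by blast

lemma weight_zero: "nonquasianalytic_weight \<omega> \<Longrightarrow> 0 \<le> t \<Longrightarrow> t \<le> 1 \<Longrightarrow> \<omega> t = 0"
  unfolding nonquasianalytic_weight_def by auto

lemma weight_mono: "nonquasianalytic_weight \<omega> \<Longrightarrow> 0 \<le> s \<Longrightarrow> s \<le> t \<Longrightarrow> \<omega> s \<le> \<omega> t"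
  unfolding nonquasianalytic_weight_def by (auto elim: mono_onD)

text \<open>Since \<omega> is increasing, the integral in condition (\<beta>), taken over [t, 2t]
  only, is at least t \<omega>(t) / (1 + 4 t^2); as the full integral is finite, \<omega> grows at
  most linearly.\<close>

lemma weight_linear_bound:
  assumes w: "nonquasianalytic_weight \<omega>"
  obtains C where "C \<ge> 0" "\<And>t. t \<ge> 0 \<Longrightarrow> \<omega> t \<le> C * (1 + t)"
proof -
  have int: "set_integrable lborel {1..} (\<lambda>t. \<omega> t / (1 + t^2))"
    using w unfolding nonquasianalytic_weight_def by blast
  define I where "I = (LINT s|lborel. indicator {1..} s *\<^sub>R (\<omega> s / (1 + s^2)))"
  have I0: "I \<ge> 0"
    unfolding I_def using weight_nonneg[OF w]
    by (intro Bochner_Integration.integral_nonneg) (auto simp: indicator_def)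
  have "\<omega> t \<le> 5 * I * (1 + t)" if "t \<ge> 0" for t
  proof (cases "t \<le> 1")
    case True
    then show ?thesis using weight_zero[OF w] that I0 by simp
  next
    case False
    then have t: "t > 1" by simp
    \<comment> \<open>A lower bound of the integrand on [t, 2t]: the numerator is smallest at the
      left end, the denominator largest at the right end.\<close>
    define c where "c = \<omega> t / (1 + (2 * t)^2)"
    have "(LINT s|lborel. indicator {t..2*t} s *\<^sub>R c) \<le> I"
      unfolding I_def
    proof (rule integral_mono)
      show "integrable lborel (\<lambda>s. indicator {t..2*t} s *\<^sub>R c)"
        by (intro integrable_scaleR_left integrable_real_indicator) (use t in auto)
      show "integrable lborel (\<lambda>s. indicator {1..} s *\<^sub>R (\<omega> s / (1 + s^2)))"
        using int unfolding set_integrable_def .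
      fix s :: real
      show "indicator {t..2*t} s *\<^sub>R c \<le> indicator {1..} s *\<^sub>R (\<omega> s / (1 + s^2))"
      proof (cases "s \<in> {t..2*t}")
        case True
        then have s: "t \<le> s" "s \<le> 2 * t" by auto
        then have "s^2 \<le> (2*t)^2"
          using t by (intro power_mono) auto
        moreover have "\<omega> t \<le> \<omega> s" "\<omega> t \<ge> 0"
          using weight_mono[OF w] weight_nonneg[OF w] s t by auto
        ultimately have "c \<le> \<omega> s / (1 + s^2)"
          unfolding c_def by (intro frac_le) (auto simp: add_pos_nonneg)
        then show ?thesis
          using True t by (simp add: indicator_def)
      next
        case False
        then show ?thesis
          using weight_nonneg[OF w] by (auto simp: indicator_def)
      qed
    qed
    then have "t * c \<le> I"
      using t by simp
    moreover have "\<omega> t \<le> 5 * t * (t * c)"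
    proof -
      have "\<omega> t = (1 + (2*t)^2) * c"
        unfolding c_def by (simp add: add_nonneg_eq_0_iff)
      also have "\<dots> \<le> (5 * t^2) * c"
      proof (rule mult_right_mono)
        show "1 + (2*t)^2 \<le> 5 * t^2"
          using t by (simp add: power_mult_distrib)
        show "c \<ge> 0"
          unfolding c_def using weight_nonneg[OF w] t by simp
      qed
      finally show ?thesis by (simp add: power2_eq_square mult_ac)
    qed
    ultimately have "\<omega> t \<le> 5 * t * I"
      using t mult_left_mono[of "t * c" I "5 * t"] by linarith
    also have "\<dots> \<le> 5 * I * (1 + t)"
      using I0 by (simp add: algebra_simps)
    finally show ?thesis .
  qed
  then show thesis
    using I0 that[of "5 * I"] by simp
qed

section \<open>Estimates for the Young conjugate\<close>

lemma young_conj_upper: "0 \<le> \<tau> \<Longrightarrow> ereal (s * \<tau> - \<omega> (exp \<tau>)) \<le> young_conj \<omega> s"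
  unfolding young_conj_def by (intro SUP_upper) simp

lemma exp_ext_ereal [simp]: "exp_ext (ereal r) = ennreal (exp r)"
  by (simp add: exp_ext_def)

text \<open>A single \<tau> in the supremum bounds the conjugate from below and hence the
  exponential from above. An infinite conjugate is covered, the left side then being 0.\<close>

lemma exp_ext_young_le:
  assumes "m \<ge> 1" "\<tau> \<ge> 0"
  shows "exp_ext (ereal x - ereal (real m) * young_conj \<omega> (real k / real m)) \<le>
    ennreal (exp (x - (real k * \<tau> - real m * \<omega> (exp \<tau>))))"
proof -
  have "ereal (real k * \<tau> - real m * \<omega> (exp \<tau>)) = ereal (real m) * ereal (real k / real m * \<tau> - \<omega> (exp \<tau>))"
    using assms(1) by (simp add: algebra_simps)
  also have "\<dots> \<le> ereal (real m) * young_conj \<omega> (real k / real m)"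
    using assms(2) by (intro ereal_mult_left_mono young_conj_upper) auto
  finally have "ereal x - ereal (real m) * young_conj \<omega> (real k / real m)
      \<le> ereal x - ereal (real k * \<tau> - real m * \<omega> (exp \<tau>))"
    by (intro ereal_minus_mono) auto
  from exp_ext_mono[OF this] show ?thesis
    by simp
qed

text \<open>The opposite direction: a common bound on all terms of the supremum bounds the conjugate
  from above.\<close>

lemma exp_ext_young_ge:
  assumes "m \<ge> 1" "\<And>\<tau>. \<tau> \<ge> 0 \<Longrightarrow> real k * \<tau> - real m * \<omega> (exp \<tau>) \<le> R"
  shows "ennreal (exp (- R)) \<le> exp_ext (- (ereal (real m) * young_conj \<omega> (real k / real m)))"
proof -
  have "young_conj \<omega> (real k / real m) \<le> ereal (R / real m)"
    unfolding young_conj_def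
  proof (rule SUP_least)
    fix \<tau> :: real assume "\<tau> \<in> {0..}"
    then have "(real k * \<tau> - real m * \<omega> (exp \<tau>)) / real m \<le> R / real m"
      using assms(2)[of \<tau>] by (intro divide_right_mono) auto
    then show "ereal (real k / real m * \<tau> - \<omega> (exp \<tau>)) \<le> ereal (R / real m)"
      using assms(1) by (simp add: diff_divide_distrib)
  qed
  then have "ereal (real m) * young_conj \<omega> (real k / real m) \<le> ereal (real m) * ereal (R / real m)"
    by (intro ereal_mult_left_mono) auto
  also have "\<dots> = ereal R"
    using assms(1) by simp
  finally have "ereal (- R) \<le> - (ereal (real m) * young_conj \<omega> (real k / real m))"
    by (metis ereal_minus_le_minus uminus_ereal.simps(1))
  from exp_ext_mono[OF this] show ?thesis
    by simp
qed

text \<open>Write \<phi>(t) for \<open>\<omega> (exp t)\<close>. If k / M is close to the slope of a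
  supporting line of \<phi> at t, then k \<tau> - M \<phi>(\<tau>) exceeds its value at t by at most
  the rounding error t. Replacing M = m + d by m gains d \<phi>(t), which by condition (\<gamma>)
  outweighs t and the constant \<open>L\<close> once t is large.\<close>

lemma weight_conj_gap:
  assumes w: "nonquasianalytic_weight \<omega>"
  obtains M :: nat where "M \<ge> 1"
    "\<And>L. \<exists>k t. t \<ge> 0 \<and> (\<forall>\<tau>\<ge>0. real k * \<tau> - real M * \<omega> (exp \<tau>) \<le> real k * t - real m * \<omega> (exp t) - L)"
proof -
  obtain a b where b: "b > 0" and ab: "\<And>t. t \<ge> 0 \<Longrightarrow> \<omega> t \<ge> a + b * ln (1 + t)"
    using w unfolding nonquasianalytic_weight_def by blast
  have conv: "convex_on UNIV (\<lambda>t. \<omega> (exp t))"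
    using w unfolding nonquasianalytic_weight_def by blast
  \<comment> \<open>With d b at least 2, the term d \<phi>(t) pays for the rounding error t and
    leaves another t to reach \<open>L\<close>.\<close>
  define d where "d = nat \<lceil>2 / b\<rceil> + 1"
  have d: "real d * b \<ge> 2"
  proof -
    have "2 / b \<le> real d" unfolding d_def by linarith
    then show ?thesis using b by (simp add: field_simps)
  qed
  define M where "M = m + d"
  have gap: "\<exists>k t. t \<ge> 0 \<and> (\<forall>\<tau>\<ge>0. real k * \<tau> - real M * \<omega> (exp \<tau>) \<le> real k * t - real m * \<omega> (exp t) - L)" for L
  proof -
    \<comment> \<open>Subtracting d a compensates the additive constant of condition
      (\<gamma>).\<close>
    define t where "t = max 1 (L - real d * a)"
    \<comment> \<open>The infimum of the difference quotients to the right is the right derivative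
      at t; by convexity it is the slope of a supporting line.\<close>
    define s where "s = Inf ((\<lambda>u. (\<omega> (exp t) - \<omega> (exp u)) / (t - u)) ` ({t<..} \<inter> UNIV))"
    define k where "k = nat \<lfloor>real M * s\<rfloor>"
    have sub: "\<omega> (exp y) \<ge> \<omega> (exp t) + s * (y - t)" for y
      unfolding s_def by (rule convex_le_Inf_differential[OF conv]) auto
    have "\<omega> (exp (t - 1)) \<le> \<omega> (exp t)"
      by (intro weight_mono[OF w]) auto
    \<comment> \<open>With a nonnegative slope, \<open>nat\<close> and the floor together lose only
      a fractional part of M s.\<close>
    then have s0: "s \<ge> 0"
      using sub[of "t - 1"] by simp
    have k: "real k \<le> real M * s" "real M * s - real k \<le> 1"
      unfolding k_def using s0 by (auto simp: of_nat_nat) linarith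
    have t: "t \<ge> 0" "t \<ge> L - real d * a"
      unfolding t_def by auto
    have "ln (exp t) \<le> ln (1 + exp t)"
      by (subst ln_le_cancel_iff) (auto simp: add_pos_pos)
    then have "\<omega> (exp t) \<ge> a + b * t"
      using ab[of "exp t"] mult_left_mono[of t "ln (1 + exp t)" b, OF _ less_imp_le[OF b]] by simp
    then have "real d * \<omega> (exp t) \<ge> real d * (a + b * t)"
      by (intro mult_left_mono) auto
    moreover have "real d * b * t \<ge> 2 * t"
      using d t(1) by (rule mult_right_mono)
    ultimately have dL: "real d * \<omega> (exp t) - t \<ge> L"
      using t by (simp add: algebra_simps)
    have "real k * \<tau> - real M * \<omega> (exp \<tau>) \<le> real k * t - real m * \<omega> (exp t) - L" if "\<tau> \<ge> 0" for \<tau>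
    proof -
      have "real M * \<omega> (exp \<tau>) \<ge> real M * (\<omega> (exp t) + s * (\<tau> - t))"
        by (intro mult_left_mono sub) auto
      then have "real k * \<tau> - real M * \<omega> (exp \<tau>) \<le>
          real k * t - real M * \<omega> (exp t) + (real M * s - real k) * (t - \<tau>)"
        by (simp add: algebra_simps)
      also have "(real M * s - real k) * (t - \<tau>) \<le> (real M * s - real k) * t"
        using k that by (intro mult_left_mono) auto
      also have "\<dots> \<le> 1 * t"
        using k t by (intro mult_right_mono) auto
      finally have "real k * \<tau> - real M * \<omega> (exp \<tau>) \<le> real k * t - real M * \<omega> (exp t) + t"
        by simp
      also have "\<dots> = real k * t - real m * \<omega> (exp t) - (real d * \<omega> (exp t) - t)"
        unfolding M_def by (simp add: algebra_simps)
      finally show ?thesis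
        using dL by linarith
    qed
    then show ?thesis
      using t(1) by blast
  qed
  have "M \<ge> 1"
    unfolding M_def d_def by simp
  then show thesis
    using gap that by blast
qed

section \<open>The one-dimensional Gaussian and its derivatives\<close>

definition gauss :: "complex \<Rightarrow> nat \<Rightarrow> real \<Rightarrow> complex" where
  "gauss z k t = (deriv ^^ k) (\<lambda>w. exp (z * w - w^2 / 2)) (of_real t)"

text \<open>\<open>gauss\<close> is defined by complex derivatives of this entire function and
  restricted to the real line, which makes Cauchy estimates available.\<close>

lemma holomorphic_gauss: "(\<lambda>w. exp (z * w - w^2 / 2)) holomorphic_on S"
  by (intro holomorphic_intros) auto

lemma deriv_seq_gauss: "deriv_seq (gauss z)"
  unfolding deriv_seq_def gauss_def
  by (intro allI has_vector_derivative_real_field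
      has_field_derivative_higher_deriv[OF holomorphic_gauss[of z UNIV]]) auto

lemma gauss_0: "gauss z 0 t = exp (z * of_real t - of_real t^2 / 2)"
  by (simp add: gauss_def)

text \<open>Cauchy's inequality on the circle of radius r about t. The radius is left free: it is
  later adapted to the weight, so that the growth of the derivatives can be matched against the
  Young conjugate.\<close>

lemma gauss_bound:
  assumes r: "r > 0"
  shows "norm (gauss z k t) \<le> fact k / r^k * (exp (2 * (r + norm z)^2) * exp (- (t^2) / 4))"
proof -
  let ?h = "\<lambda>w. exp (z * w - w^2 / 2)"
  let ?B = "exp (2 * (r + norm z)^2) * exp (- (t^2) / 4)"
  have "norm ((deriv ^^ k) ?h (of_real t)) \<le> fact k * ?B / r^k"
  proof (rule Cauchy_inequality)
    show "?h holomorphic_on ball (of_real t) r"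
      by (rule holomorphic_gauss)
    show "continuous_on (cball (of_real t) r) ?h"
      by (intro holomorphic_on_imp_continuous_on holomorphic_gauss)
    show "0 < r" by fact
    fix w :: complex assume w: "norm (of_real t - w) = r"
    define v where "v = w - of_real t"
    have v: "norm v = r" "w = of_real t + v"
      using w by (auto simp: v_def norm_minus_commute)
    have Rv: "\<bar>Re v\<bar> \<le> r" "\<bar>Im v\<bar> \<le> r"
      using abs_Re_le_cmod[of v] abs_Im_le_cmod[of v] v by auto
    define R where "R = r + norm z"
    have "Re (z * w) \<le> norm z * norm w"
      using complex_Re_le_cmod[of "z * w"] by (simp add: norm_mult)
    also have "\<dots> \<le> norm z * (\<bar>t\<bar> + r)"
      unfolding v(2) using norm_triangle_ineq[of "of_real t" v] v(1) by (intro mult_left_mono) auto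
    finally have 1: "Re (z * w) \<le> norm z * (\<bar>t\<bar> + r)" .
    have "Re (w^2) = (t + Re v)^2 - (Im v)^2"
      unfolding v(2) by (simp add: power2_eq_square)
    also have "\<dots> = t^2 + 2 * (t * Re v) + (Re v)^2 - (Im v)^2"
      by (simp add: power2_eq_square algebra_simps)
    also have "\<dots> \<ge> t^2 - 2 * (\<bar>t\<bar> * r) - r^2"
    proof -
      have "\<bar>t * Re v\<bar> \<le> \<bar>t\<bar> * r"
        unfolding abs_mult using Rv by (intro mult_left_mono) auto
      moreover have "(Im v)^2 \<le> r^2"
        using Rv by (metis abs_ge_zero power2_abs power_mono)
      ultimately show ?thesis
        using zero_le_power2[of "Re v"] by linarith
    qed
    finally have 2: "Re (w^2) \<ge> t^2 - 2 * (\<bar>t\<bar> * r) - r^2" .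
    have "Re (z * w - w^2 / 2) \<le> R * \<bar>t\<bar> - t^2 / 2 + norm z * r + r^2 / 2"
      using 1 2 by (simp add: R_def algebra_simps)
    moreover have "norm z * r + r^2 / 2 \<le> R^2"
      using r unfolding R_def by (simp add: power2_eq_square algebra_simps)
    \<comment> \<open>Half of the quadratic decay absorbs the linear term, by completing the
      square.\<close>
    moreover have "R * \<bar>t\<bar> - t^2 / 2 \<le> R^2 - t^2 / 4"
      using zero_le_power2[of "R - \<bar>t\<bar> / 2"] by (simp add: power2_eq_square algebra_simps)
    ultimately have "Re (z * w - w^2 / 2) \<le> 2 * R^2 + - (t^2) / 4"
      by linarith
    then show "norm (?h w) \<le> ?B"
      unfolding R_def exp_add[symmetric] by simp
  qed
  then show ?thesis
    by (simp add: gauss_def)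
qed

text \<open>Repeated differentiation of h' = (z - w) h. With the probabilists' Hermite polynomials
  He the k-th derivative is (-1)^k He_k(w - z) h(w), and this is their three-term recursion. For k =
  0 the truncated index \<open>k - 1\<close> comes with the factor 0.\<close>

lemma gauss_Suc:
  fixes z w :: complex
  shows "(deriv ^^ Suc k) (\<lambda>w. exp (z * w - w^2 / 2)) w =
    (z - w) * (deriv ^^ k) (\<lambda>w. exp (z * w - w^2 / 2)) w - of_nat k * (deriv ^^ (k - 1)) (\<lambda>w. exp (z * w - w^2 / 2)) w"
proof -
  define D :: "nat \<Rightarrow> complex \<Rightarrow> complex" where "D k = (deriv ^^ k) (\<lambda>w. exp (z * w - w^2 / 2))" for k
  have D: "(D k has_field_derivative D (Suc k) w) (at w)" for k w
    unfolding D_def by (rule has_field_derivative_higher_deriv[OF holomorphic_gauss open_UNIV UNIV_I])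
  have "D (Suc k) w = (z - w) * D k w - of_nat k * D (k - 1) w" for w
  proof (induction k arbitrary: w)
    case 0
    have "(D 0 has_field_derivative exp (z * w - w^2 / 2) * (z - w)) (at w)"
      unfolding D_def by (auto intro!: derivative_eq_intros)
    then show ?case
      using DERIV_unique[OF D[of 0 w]] by (simp add: D_def)
  next
    case (Suc k)
    have "((\<lambda>w. (z - w) * D k w - of_nat k * D (k - 1) w) has_field_derivative
        (z - w) * D (Suc k) w - D k w - of_nat k * D (Suc (k - 1)) w) (at w)"
      by (auto intro!: derivative_eq_intros D)
    then have "(D (Suc k) has_field_derivative
        (z - w) * D (Suc k) w - D k w - of_nat k * D (Suc (k - 1)) w) (at w)"
      unfolding ext[of "D (Suc k)", OF Suc.IH, symmetric] .
    \<comment> \<open>\<open>Suc (k - 1)\<close> differs from k when k = 0, but then its factor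
      vanishes; hence the case split.\<close>
    from DERIV_unique[OF D this] show ?case
      by (cases k) (auto simp: algebra_simps)
  qed
  then show ?thesis
    unfolding D_def .
qed

text \<open>
  All terms of the recursion for the values at \<open>0\<close> have the same phase \<open>\<i>\<^sup>k\<close>, so nothing cancels.
\<close>

lemma gauss_lower_bound:
  assumes "\<xi> \<ge> 0"
  shows "\<xi> ^ k \<le> norm (gauss (\<i> * of_real \<xi>) k 0)"
proof -
  have "\<exists>H\<ge>\<xi> ^ k. gauss (\<i> * of_real \<xi>) k 0 = \<i> ^ k * of_real H" for k
  proof (induction k rule: less_induct)
    case (less k)
    have rec: "gauss (\<i> * of_real \<xi>) (Suc n) 0 =
        \<i> * of_real \<xi> * gauss (\<i> * of_real \<xi>) n 0 - of_nat n * gauss (\<i> * of_real \<xi>) (n - 1) 0" for n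
      unfolding gauss_def by (subst gauss_Suc) simp
    consider "k = 0" | "k = 1" | n where "k = Suc (Suc n)"
      by (metis One_nat_def not0_implies_Suc)
    then show ?case
    proof cases
      case 1
      then show ?thesis by (auto simp: gauss_0 intro!: exI[of _ 1])
    next
      case 2
      then show ?thesis using rec[of 0] by (auto simp: gauss_0 intro!: exI[of _ \<xi>])
    next
      case 3
      obtain H H' where H: "H \<ge> \<xi> ^ Suc n" "gauss (\<i> * of_real \<xi>) (Suc n) 0 = \<i> ^ Suc n * of_real H"
        and H': "H' \<ge> \<xi> ^ n" "gauss (\<i> * of_real \<xi>) n 0 = \<i> ^ n * of_real H'"
        using less.IH[of "Suc n"] less.IH[of n] 3 by auto
      have "gauss (\<i> * of_real \<xi>) k 0 =
          \<i> * of_real \<xi> * (\<i> ^ Suc n * of_real H) - of_nat (Suc n) * (\<i> ^ n * of_real H')"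
        unfolding 3 rec[of "Suc n"] H(2) diff_Suc_1 H'(2) ..
      \<comment> \<open>As \<i>^2 = -1, the minus sign of the recursion becomes a plus sign in front
        of H'.\<close>
      also have "\<dots> = \<i> ^ k * of_real (\<xi> * H + real (Suc n) * H')"
        unfolding 3 by (simp add: algebra_simps)
      finally have "gauss (\<i> * of_real \<xi>) k 0 = \<i> ^ k * of_real (\<xi> * H + real (Suc n) * H')" .
      moreover have "H' \<ge> 0" "\<xi> * H \<ge> \<xi> ^ k"
        using H'(1) zero_le_power[OF assms, of n] mult_left_mono[OF H(1) assms] 3 by auto
      moreover from this have "\<xi> ^ k \<le> \<xi> * H + real (Suc n) * H'"
        by (intro add_increasing2) auto
      ultimately show ?thesis
        by blast
    qed
  qed
  then obtain H where "H \<ge> \<xi> ^ k" "gauss (\<i> * of_real \<xi>) k 0 = \<i> ^ k * of_real H"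
    by blast
  then show ?thesis
    by (simp add: norm_mult norm_power)
qed

text \<open>Up to the factor sqrt(2 pi), this is the characteristic function of the standard normal
  distribution at s.\<close>

lemma gauss_integral:
  shows "integrable lborel (\<lambda>t. gauss (\<i> * of_real s) 0 t)"
    and "(LINT t|lborel. gauss (\<i> * of_real s) 0 t) = of_real (sqrt (2 * pi) * exp (- (s^2) / 2))"
proof -
  have eq: "gauss (\<i> * of_real s) 0 t = sqrt (2 * pi) *\<^sub>R (std_normal_density t *\<^sub>R iexp (s * t))" for t
  proof -
    have "exp (\<i> * of_real s * of_real t - of_real t^2 / 2) =
        exp (of_real (- (t^2) / 2)) * iexp (s * t)"
      unfolding exp_add[symmetric] by (simp add: mult.assoc)
    then show ?thesis
      unfolding gauss_0 std_normal_density_def exp_of_real by (simp add: scaleR_conv_of_real)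
  qed
  have [measurable]: "(\<lambda>t. iexp (s * t)) \<in> borel_measurable lborel"
    by measurable
  have int: "integrable lborel (\<lambda>t. std_normal_density t *\<^sub>R iexp (s * t))"
    using integrable_std_normal_moment[of 0]
    by (rule Bochner_Integration.integrable_bound) (auto simp: normal_density_nonneg)
  then show "integrable lborel (\<lambda>t. gauss (\<i> * of_real s) 0 t)"
    unfolding eq by (rule integrable_scaleR_right)
  have "(LINT t|lborel. std_normal_density t *\<^sub>R iexp (s * t)) = char std_normal_distribution s"
    unfolding char_def by (subst integral_density) (auto simp: normal_density_nonneg)
  then show "(LINT t|lborel. gauss (\<i> * of_real s) 0 t) = of_real (sqrt (2 * pi) * exp (- (s^2) / 2))"
    unfolding eq by (simp add: char_std_normal_distribution scaleR_conv_of_real)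
qed

section \<open>Modulated Gaussians\<close>

text \<open>Fubini for a product of functions of one coordinate each. \<open>lborel\<close> on the
  vector type is an image of the product measure indexed by \<open>Basis\<close>, so the factors are
  first reindexed from coordinates to the vectors \<open>axis j 1\<close>.\<close>

lemma integral_prod_components:
  fixes f :: "'n::finite \<Rightarrow> real \<Rightarrow> complex"
  assumes f: "\<And>j. integrable lborel (f j)"
  shows "integrable lborel (\<lambda>x::real^'n. \<Prod>j\<in>UNIV. f j (x $ j))"
    and "(LINT x|lborel. (\<Prod>j\<in>UNIV. f j ((x::real^'n) $ j))) = (\<Prod>j\<in>UNIV. LINT t|lborel. f j t)"
proof -
  let ?B = "Basis :: (real^'n) set"
  have B: "?B = range (\<lambda>j. axis j 1)"
    by (auto simp: Basis_vec_def)
  have inj: "inj (\<lambda>j::'n. axis j (1::real))"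
    by (auto simp: inj_on_def axis_eq_axis)
  define F where "F b = f (the_inv (\<lambda>j. axis j 1) b)" for b :: "real^'n"
  have F: "F (axis j 1) = f j" for j
    unfolding F_def by (simp add: the_inv_f_f[OF inj])
  have prod_B: "(\<Prod>b\<in>?B. g (F b) b) = (\<Prod>j\<in>UNIV. g (f j) (axis j 1))" for g :: "_ \<Rightarrow> _ \<Rightarrow> complex"
    unfolding B by (subst prod.reindex[OF inj]) (simp add: F)
  interpret product_sigma_finite "\<lambda>b::real^'n. lborel :: real measure" ..
  let ?h = "\<lambda>y::(real^'n) \<Rightarrow> real. \<Sum>b\<in>?B. y b *\<^sub>R b"
  have [measurable]: "F b \<in> borel_measurable borel" for b
    using borel_measurable_integrable[OF f] unfolding F_def by simp
  have [measurable]: "f j \<in> borel_measurable borel" for j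
    using borel_measurable_integrable[OF f] by simp
  have comp: "(\<Prod>j\<in>UNIV. f j (?h y $ j)) = (\<Prod>b\<in>?B. F b (y b))" for y
  proof -
    have "?h y $ j = y (axis j 1)" for j
      by (simp add: cart_eq_inner_axis inner_sum_left_Basis axis_in_Basis_iff)
    then show ?thesis
      using prod_B[of "\<lambda>u b. u (y b)"] by simp
  qed
  have int_F: "integrable lborel (F b)" for b
    unfolding F_def by (rule f)
  have meas: "(\<lambda>x::real^'n. \<Prod>j\<in>UNIV. f j (x $ j)) \<in> borel_measurable borel"
    by measurable
  have h: "?h \<in> (\<Pi>\<^sub>M b\<in>?B. lborel) \<rightarrow>\<^sub>M borel"
    by measurable
  have "integrable (\<Pi>\<^sub>M b\<in>?B. lborel) (\<lambda>y. \<Prod>b\<in>?B. F b (y b))"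
    by (intro product_integrable_prod int_F) auto
  then show "integrable lborel (\<lambda>x::real^'n. \<Prod>j\<in>UNIV. f j (x $ j))"
    by (subst lborel_eq) (simp only: integrable_distr_eq[OF h meas] comp)
  have "(LINT x|lborel. (\<Prod>j\<in>UNIV. f j ((x::real^'n) $ j))) =
      integral\<^sup>L (\<Pi>\<^sub>M b\<in>?B. lborel) (\<lambda>y. \<Prod>b\<in>?B. F b (y b))"
    by (subst lborel_eq) (simp only: integral_distr[OF h meas] comp)
  also have "\<dots> = (\<Prod>b\<in>?B. LINT t|lborel. F b t)"
    by (intro product_integral_prod int_F) auto
  also have "\<dots> = (\<Prod>j\<in>UNIV. LINT t|lborel. f j t)"
    using prod_B[of "\<lambda>u b. LINT t|lborel. u t"] by simp
  finally show "(LINT x|lborel. (\<Prod>j\<in>UNIV. f j ((x::real^'n) $ j))) = (\<Prod>j\<in>UNIV. LINT t|lborel. f j t)" .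
qed

abbreviation gaussian :: "('n::finite \<Rightarrow> complex) \<Rightarrow> ('n \<Rightarrow> nat) \<Rightarrow> real^'n \<Rightarrow> complex" where
  "gaussian z \<equiv> tensor (\<lambda>j. gauss (z j))"

text \<open>The one-dimensional bounds multiply. Enlarging each factorial to a power of
  \<open>multi_order \<alpha>\<close> + 1 makes the bound depend on \<alpha> through its order
  alone; this base is at least 1, so its logarithm can be inserted in the Young conjugate.\<close>

lemma gaussian_bound:
  fixes z :: "'n::finite \<Rightarrow> complex"
  assumes r: "r > 0"
  obtains A where "A \<ge> 0"
    "\<And>\<alpha> x. norm (gaussian z \<alpha> x) \<le> A * ((real (multi_order \<alpha>) + 1) / r) ^ multi_order \<alpha> * exp (- (norm x ^ 2) / 4)"
proof -
  define a where "a j = exp (2 * (r + norm (z j))^2)" for j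
  have "norm (gaussian z \<alpha> x) \<le> (\<Prod>j\<in>UNIV. a j) * ((real (multi_order \<alpha>) + 1) / r) ^ multi_order \<alpha> * exp (- (norm x ^ 2) / 4)"
    for \<alpha> x
  proof -
    let ?c = "(real (multi_order \<alpha>) + 1) / r"
    have le: "norm (gauss (z j) (\<alpha> j) (x $ j)) \<le> ?c ^ \<alpha> j * (a j * exp (- ((x $ j)^2) / 4))" for j
    proof -
      have "\<alpha> j \<le> multi_order \<alpha>"
        unfolding multi_order_def by (rule member_le_sum) auto
      then have "real (\<alpha> j) ^ \<alpha> j \<le> (real (multi_order \<alpha>) + 1) ^ \<alpha> j"
        by (intro power_mono) auto
      moreover have "(fact (\<alpha> j) :: real) \<le> real (\<alpha> j) ^ \<alpha> j"
        using fact_le_power[of "\<alpha> j", where 'a = real] by simp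
      ultimately have "fact (\<alpha> j) / r ^ \<alpha> j \<le> ?c ^ \<alpha> j"
        unfolding power_divide using r by (intro divide_right_mono) auto
      then show ?thesis
        using gauss_bound[OF r, of "z j" "\<alpha> j" "x $ j"] unfolding a_def
        by (elim order_trans) (intro mult_right_mono, auto)
    qed
    have "norm (gaussian z \<alpha> x) = (\<Prod>j\<in>UNIV. norm (gauss (z j) (\<alpha> j) (x $ j)))"
      unfolding tensor_def by (rule prod_norm[symmetric])
    also have "\<dots> \<le> (\<Prod>j\<in>UNIV. ?c ^ \<alpha> j * (a j * exp (- ((x $ j)^2) / 4)))"
      using le by (intro prod_mono) auto
    also have "\<dots> = ?c ^ multi_order \<alpha> * ((\<Prod>j\<in>UNIV. a j) * exp (\<Sum>j\<in>UNIV. - ((x $ j)^2) / 4))"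
      unfolding multi_order_def by (simp add: prod.distrib power_sum exp_sum)
    also have "(\<Sum>j\<in>UNIV. - ((x $ j)^2) / 4) = - (norm x ^ 2) / 4"
      unfolding power2_norm_eq_inner inner_vec_def by (simp add: sum_negf sum_divide_distrib power2_eq_square)
    finally show ?thesis
      by (simp add: mult_ac)
  qed
  moreover have "(\<Prod>j\<in>UNIV. a j) \<ge> 0"
    by (intro prod_nonneg) (simp add: a_def)
  ultimately show thesis
    using that by blast
qed

text \<open>Linear growth of \<omega> against quadratic decay, again by completing the
  square.\<close>

lemma exp_weight_gaussian_bounded:
  assumes w: "nonquasianalytic_weight \<omega>" and l: "l \<ge> 0"
  obtains B where "B \<ge> 0" "\<And>u. u \<ge> 0 \<Longrightarrow> exp (l * \<omega> u) * exp (- (u ^ 2) / 4) \<le> B"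
proof -
  obtain C where C: "C \<ge> 0" "\<And>t. t \<ge> 0 \<Longrightarrow> \<omega> t \<le> C * (1 + t)"
    using weight_linear_bound[OF w] by blast
  have "exp (l * \<omega> u) * exp (- (u ^ 2) / 4) \<le> exp (l * C + (l * C)^2)" if "u \<ge> 0" for u
  proof -
    have "l * \<omega> u \<le> l * (C * (1 + u))"
      using C(2)[OF that] l by (rule mult_left_mono)
    moreover have "l * C * u - u^2 / 4 \<le> (l * C)^2"
      using zero_le_power2[of "l * C - u / 2"] by (simp add: power2_eq_square algebra_simps)
    ultimately have "l * \<omega> u + - (u ^ 2) / 4 \<le> l * C + (l * C)^2"
      by (simp add: algebra_simps)
    then show ?thesis
      unfolding exp_add[symmetric] by simp
  qed
  then show thesis
    using that[of "exp (l * C + (l * C)^2)"] by simp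
qed

lemma smooth_gaussian: "smooth (gaussian z \<alpha>)"
  by (rule smooth_tensor) (rule deriv_seq_gauss)

lemma multi_deriv_gaussian: "multi_deriv \<alpha> (gaussian z (\<lambda>_. 0)) = gaussian z \<alpha>"
  by (rule multi_deriv_tensor) (rule deriv_seq_gauss)

lemma gaussian_weighted_bdd:
  assumes w: "nonquasianalytic_weight \<omega>" and l: "l \<ge> 0"
  shows "bdd_above (range (\<lambda>x. exp (l * \<omega> (norm x)) * norm (gaussian z \<alpha> x)))"
proof -
  obtain A where A: "A \<ge> 0"
    "\<And>\<alpha> x. norm (gaussian z \<alpha> x) \<le> A * ((real (multi_order \<alpha>) + 1) / 1) ^ multi_order \<alpha> * exp (- (norm x ^ 2) / 4)"
    using gaussian_bound[of 1 z] by auto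
  obtain B where B: "\<And>u. u \<ge> 0 \<Longrightarrow> exp (l * \<omega> u) * exp (- (u ^ 2) / 4) \<le> B"
    using exp_weight_gaussian_bounded[OF w l] by blast
  let ?c = "A * ((real (multi_order \<alpha>) + 1) / 1) ^ multi_order \<alpha>"
  have "exp (l * \<omega> (norm x)) * norm (gaussian z \<alpha> x) \<le> ?c * B" for x
  proof -
    have "exp (l * \<omega> (norm x)) * norm (gaussian z \<alpha> x) \<le> exp (l * \<omega> (norm x)) * (?c * exp (- (norm x ^ 2) / 4))"
      by (intro mult_left_mono A(2)) auto
    also have "\<dots> = ?c * (exp (l * \<omega> (norm x)) * exp (- (norm x ^ 2) / 4))"
      by (simp add: mult_ac)
    also have "\<dots> \<le> ?c * B"
      using A(1) by (intro mult_left_mono B) auto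
    finally show ?thesis .
  qed
  then show ?thesis
    by (intro bdd_aboveI2)
qed

text \<open>Derivatives of order K grow at most like ((K + 1) / r)^K. Testing the conjugate at
  \<tau> = ln (K + 1) contributes at most r^(K + 2) / (K + 1)^K, so all powers depending on K cancel
  and r^2 remains.\<close>

lemma q_norm_gaussian_finite:
  assumes w: "nonquasianalytic_weight \<omega>" and m: "m \<ge> 1"
  shows "q_norm \<omega> m n (gaussian z (\<lambda>_. 0)) < \<infinity>"
proof -
  obtain C where C: "C \<ge> 0" "\<And>t. t \<ge> 0 \<Longrightarrow> \<omega> t \<le> C * (1 + t)"
    using weight_linear_bound[OF w] by blast
  \<comment> \<open>With this radius r^(K + 2) is the bound that linear growth gives for exp(m
    \<omega>(K + 1)).\<close>
  define r where "r = exp (real m * C)"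
  have "r > 0" by (simp add: r_def)
  obtain A where A: "A \<ge> 0"
    "\<And>\<alpha> x. norm (gaussian z \<alpha> x) \<le> A * ((real (multi_order \<alpha>) + 1) / r) ^ multi_order \<alpha> * exp (- (norm x ^ 2) / 4)"
    using gaussian_bound[OF \<open>r > 0\<close>] by blast
  obtain B where B: "B \<ge> 0" "\<And>u. u \<ge> 0 \<Longrightarrow> exp (real n * \<omega> u) * exp (- (u ^ 2) / 4) \<le> B"
    using exp_weight_gaussian_bounded[OF w, of "real n"] by auto
  have "(SUP x. ennreal (exp (real n * \<omega> (norm x)) * norm (gaussian z \<alpha> x))) *
     exp_ext (- (ereal (real m) * young_conj \<omega> (real (multi_order \<alpha>) / real m))) \<le> ennreal (A * B * r ^ 2)" for \<alpha>
  proof -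
    define K where "K = multi_order \<alpha>"
    let ?c = "A * ((real K + 1) / r) ^ K"
    have "exp (real n * \<omega> (norm x)) * norm (gaussian z \<alpha> x) \<le> ?c * B" for x
    proof -
      have "exp (real n * \<omega> (norm x)) * norm (gaussian z \<alpha> x) \<le> exp (real n * \<omega> (norm x)) * (?c * exp (- (norm x ^ 2) / 4))"
        unfolding K_def by (intro mult_left_mono A(2)) auto
      also have "\<dots> = ?c * (exp (real n * \<omega> (norm x)) * exp (- (norm x ^ 2) / 4))"
        by (simp add: mult_ac)
      also have "\<dots> \<le> ?c * B"
        using A(1) \<open>r > 0\<close> by (intro mult_left_mono B) auto
      finally show ?thesis .
    qed
    then have 1: "(SUP x. ennreal (exp (real n * \<omega> (norm x)) * norm (gaussian z \<alpha> x))) \<le> ennreal (?c * B)"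
      by (intro SUP_least ennreal_leI)
    have "real m * \<omega> (real K + 1) \<le> real m * (C * (real K + 2))"
      using C(2)[of "real K + 1"] by (intro mult_left_mono) (auto simp: add_ac)
    then have "exp (0 - (real K * ln (real K + 1) - real m * \<omega> (exp (ln (real K + 1)))))
        \<le> exp (real m * C * real (K + 2) - real K * ln (real K + 1))"
      by (simp add: algebra_simps)
    also have "\<dots> = r ^ (K + 2) / (real K + 1) ^ K"
    proof -
      have "exp (real K * ln (real K + 1)) = (real K + 1) ^ K"
        by (simp add: exp_of_nat_mult)
      then show ?thesis
        unfolding r_def exp_diff by (simp only: exp_of_nat2_mult)
    qed
    finally have "ennreal (exp (0 - (real K * ln (real K + 1) - real m * \<omega> (exp (ln (real K + 1))))))
        \<le> ennreal (r ^ (K + 2) / (real K + 1) ^ K)"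
      by (rule ennreal_leI)
    moreover have "exp_ext (- (ereal (real m) * young_conj \<omega> (real K / real m))) =
        exp_ext (ereal 0 - ereal (real m) * young_conj \<omega> (real K / real m))"
      by (simp add: zero_ereal_def[symmetric])
    ultimately have 2: "exp_ext (- (ereal (real m) * young_conj \<omega> (real K / real m)))
        \<le> ennreal (r ^ (K + 2) / (real K + 1) ^ K)"
      using exp_ext_young_le[OF m, of "ln (real K + 1)" 0 \<omega> K] by (auto intro: order_trans)
    have "?c * B * (r ^ (K + 2) / (real K + 1) ^ K) = A * B * r ^ 2"
      using \<open>r > 0\<close> by (simp add: power_divide power_add power2_eq_square field_simps)
    moreover have "?c * B \<ge> 0"
      using A(1) B(1) \<open>r > 0\<close> by simp
    ultimately show ?thesis
      using mult_mono[OF 1 2] \<open>r > 0\<close> unfolding K_def by (simp add: ennreal_mult[symmetric])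
  qed
  then have "q_norm \<omega> m n (gaussian z (\<lambda>_. 0)) \<le> ennreal (A * B * r ^ 2)"
    unfolding q_norm_def multi_deriv_gaussian by (rule SUP_least)
  then show ?thesis
    by (rule le_less_trans) simp
qed

text \<open>The oscillating factor splits over the coordinates and shifts each frequency, so every
  factor is a known one-dimensional integral. Expanding the square shows the same kind of function,
  with real parameters: a translated Gaussian up to a constant.\<close>

lemma fourier_gaussian:
  "fourier (gaussian (\<lambda>j. \<i> * of_real (\<eta> j)) (\<lambda>_. 0)) =
    (\<lambda>\<xi>. of_real (\<Prod>j\<in>UNIV. sqrt (2 * pi) * exp (- (\<eta> j ^ 2) / 2)) * gaussian (\<lambda>j. of_real (\<eta> j)) (\<lambda>_. 0) \<xi>)"
proof
  fix \<xi> :: "real^'a"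
  have "exp (- (\<i> * complex_of_real (x \<bullet> \<xi>))) * gaussian (\<lambda>j. \<i> * of_real (\<eta> j)) (\<lambda>_. 0) x =
      (\<Prod>j\<in>UNIV. gauss (\<i> * of_real (\<eta> j - \<xi> $ j)) 0 (x $ j))" for x
  proof -
    have "- (\<i> * complex_of_real (x \<bullet> \<xi>)) = (\<Sum>j\<in>UNIV. - (\<i> * of_real (x $ j * \<xi> $ j)))"
      by (simp add: inner_vec_def sum_negf sum_distrib_left)
    then have "exp (- (\<i> * complex_of_real (x \<bullet> \<xi>))) = (\<Prod>j\<in>UNIV. exp (- (\<i> * of_real (x $ j * \<xi> $ j))))"
      by (simp only: exp_sum[OF finite])
    then have "exp (- (\<i> * complex_of_real (x \<bullet> \<xi>))) * gaussian (\<lambda>j. \<i> * of_real (\<eta> j)) (\<lambda>_. 0) x =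
        (\<Prod>j\<in>UNIV. exp (- (\<i> * of_real (x $ j * \<xi> $ j))) * gauss (\<i> * of_real (\<eta> j)) 0 (x $ j))"
      by (simp only: tensor_def prod.distrib)
    also have "\<dots> = (\<Prod>j\<in>UNIV. gauss (\<i> * of_real (\<eta> j - \<xi> $ j)) 0 (x $ j))"
      unfolding gauss_0 exp_add[symmetric] by (intro prod.cong refl arg_cong[where f = exp]) (simp add: algebra_simps)
    finally show ?thesis .
  qed
  then have "fourier (gaussian (\<lambda>j. \<i> * of_real (\<eta> j)) (\<lambda>_. 0)) \<xi> =
      (LINT x|lborel. (\<Prod>j\<in>UNIV. gauss (\<i> * of_real (\<eta> j - \<xi> $ j)) 0 ((x::real^'a) $ j)))"
    unfolding fourier_def by presburger
  also have "\<dots> = (\<Prod>j\<in>UNIV. of_real (sqrt (2 * pi) * exp (- ((\<eta> j - \<xi> $ j)^2) / 2)))"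
    by (subst integral_prod_components(2)) (simp_all only: gauss_integral)
  also have "\<dots> = (\<Prod>j\<in>UNIV. of_real (sqrt (2 * pi) * exp (- (\<eta> j ^ 2) / 2)) * gauss (of_real (\<eta> j)) 0 (\<xi> $ j))"
  proof (intro prod.cong refl)
    fix j
    have "exp (- ((\<eta> j - \<xi> $ j)^2) / 2) = exp (- (\<eta> j ^ 2) / 2) * exp (\<eta> j * \<xi> $ j - (\<xi> $ j)^2 / 2)"
      unfolding exp_add[symmetric] by (simp add: power2_eq_square field_simps)
    moreover have "gauss (of_real (\<eta> j)) 0 (\<xi> $ j) = of_real (exp (\<eta> j * \<xi> $ j - (\<xi> $ j)^2 / 2))"
      unfolding gauss_0 exp_of_real[symmetric] by simp
    ultimately show "of_real (sqrt (2 * pi) * exp (- ((\<eta> j - \<xi> $ j)^2) / 2)) =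
        of_real (sqrt (2 * pi) * exp (- (\<eta> j ^ 2) / 2)) * gauss (of_real (\<eta> j)) 0 (\<xi> $ j)"
      by simp
  qed
  also have "\<dots> = of_real (\<Prod>j\<in>UNIV. sqrt (2 * pi) * exp (- (\<eta> j ^ 2) / 2)) * gaussian (\<lambda>j. of_real (\<eta> j)) (\<lambda>_. 0) \<xi>"
    by (simp only: tensor_def of_real_prod prod.distrib of_real_mult)
  finally show "fourier (gaussian (\<lambda>j. \<i> * of_real (\<eta> j)) (\<lambda>_. 0)) \<xi> =
    of_real (\<Prod>j\<in>UNIV. sqrt (2 * pi) * exp (- (\<eta> j ^ 2) / 2)) * gaussian (\<lambda>j. of_real (\<eta> j)) (\<lambda>_. 0) \<xi>" .
qed

text \<open>The Fourier transform is again of the form \<open>gaussian\<close> up to a constant, so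
  one weighted bound serves both halves of the definition.\<close>

lemma gaussian_in_S_omega:
  fixes \<eta> :: "'n::finite \<Rightarrow> real"
  assumes w: "nonquasianalytic_weight \<omega>"
  shows "gaussian (\<lambda>j. \<i> * of_real (\<eta> j)) (\<lambda>_. 0) \<in> S_omega \<omega>"
proof -
  have "integrable lborel (gaussian (\<lambda>j. \<i> * of_real (\<eta> j)) (\<lambda>_. 0))"
    unfolding tensor_def[abs_def] by (intro integral_prod_components gauss_integral)
  moreover have bdd: "bdd_above (range (\<lambda>x. exp (l * \<omega> (norm x)) * norm (c * gaussian z \<alpha> x)))"
    if "l > 0" for l c z and \<alpha> :: "'n \<Rightarrow> nat"
    using bdd_above_lincomb[OF _ _ _, of "\<lambda>x. exp (l * \<omega> (norm x))" "gaussian z \<alpha>" "gaussian z \<alpha>" c 0]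
      gaussian_weighted_bdd[OF w less_imp_le[OF that], of z \<alpha>] by simp
  moreover have "bdd_above (range (\<lambda>x. exp (l * \<omega> (norm x)) * norm (gaussian z \<alpha> x)))"
    if "l > 0" for l z and \<alpha> :: "'n \<Rightarrow> nat"
    using bdd[OF that, of 1 z \<alpha>] by simp
  ultimately show ?thesis
    unfolding S_omega_def mem_Collect_eq fourier_gaussian
    by (simp add: smooth_gaussian smooth_cmult multi_deriv_cmult multi_deriv_gaussian)
qed

section \<open>Plane waves and derivative functionals\<close>

text \<open>Domination by one seminorm, applied to differences by linearity, gives
  continuity.\<close>

lemma bounded_functional_in_dual:
  assumes V: "\<And>f g a b. f \<in> V \<Longrightarrow> g \<in> V \<Longrightarrow> (\<lambda>x. a * f x + b * g x) \<in> V"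
    and lin: "\<And>f g a b. f \<in> V \<Longrightarrow> g \<in> V \<Longrightarrow> T (\<lambda>x. a * f x + b * g x) = a * T f + b * T g"
    and out: "\<And>f. f \<notin> V \<Longrightarrow> T f = 0"
    and q: "q \<in> P" and C: "C \<ge> 0" "\<And>h. h \<in> V \<Longrightarrow> ennreal (norm (T h)) \<le> ennreal C * q h"
  shows "T \<in> dual_space V P"
proof -
  have "continuous_map (seminorm_topology V P) euclidean T"
    unfolding continuous_map_def topspace_seminorm_topology
  proof (intro conjI allI impI)
    fix U :: "complex set" assume "openin euclidean U"
    then have "open U" by simp
    show "openin (seminorm_topology V P) {x \<in> V. T x \<in> U}"
      unfolding openin_seminorm_topology
    proof (intro conjI ballI)
      fix u assume "u \<in> {x \<in> V. T x \<in> U}"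
      then have u: "u \<in> V" "T u \<in> U" by auto
      obtain e where e: "e > 0" "\<And>y. dist y (T u) < e \<Longrightarrow> y \<in> U"
        using \<open>open U\<close> u(2) unfolding open_dist by blast
      define d where "d = e / (C + 1)"
      have d: "d > 0" unfolding d_def using e(1) C(1) by simp
      have "e * C < e * (C + 1)"
        using e(1) by (intro mult_strict_left_mono) auto
      then have Cd: "C * d < e"
        unfolding d_def using C(1) by (simp add: pos_divide_less_eq mult.commute)
      have "v \<in> {x \<in> V. T x \<in> U}" if v: "v \<in> V" "q (\<lambda>x. v x - u x) < ennreal d" for v
      proof -
        have "(\<lambda>x. v x - u x) \<in> V" and T: "T (\<lambda>x. v x - u x) = T v - T u"
          using V[OF v(1) u(1), of 1 "-1"] lin[OF v(1) u(1), of 1 "-1"] by auto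
        then have "ennreal (norm (T v - T u)) \<le> ennreal C * q (\<lambda>x. v x - u x)"
          using C(2) by metis
        also have "\<dots> \<le> ennreal C * ennreal d"
          using v(2) by (intro mult_left_mono) auto
        also have "\<dots> = ennreal (C * d)"
          using C(1) by (simp add: ennreal_mult')
        finally have "norm (T v - T u) \<le> C * d"
          using C(1) d by (simp add: ennreal_le_iff)
        then show ?thesis
          using v(1) e(2) Cd by (auto simp: dist_norm)
      qed
      then show "\<exists>F e. finite F \<and> F \<subseteq> P \<and> 0 < e \<and>
          (\<forall>v\<in>V. (\<forall>p\<in>F. p (\<lambda>x. v x - u x) < ennreal e) \<longrightarrow> v \<in> {x \<in> V. T x \<in> U})"
        using q d by (intro exI[of _ "{q}"] exI[of _ d]) auto
    qed auto
  qed simp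
  moreover have "T (\<lambda>x. f x + g x) = T f + T g" "T (\<lambda>x. c * f x) = c * T f" if "f \<in> V" "g \<in> V" for f g c
    using lin[OF that, of 1 1] lin[OF that(1) that(1), of c 0] by simp_all
  ultimately show ?thesis
    unfolding dual_space_def using out by blast
qed

text \<open>Up to a constant factor, a derivative of the Dirac measure at 0. The value 0 outside
  \<open>S_omega\<close> is what \<open>dual_space\<close> prescribes.\<close>

definition point_deriv ::
    "(real \<Rightarrow> real) \<Rightarrow> real \<Rightarrow> ('n::finite \<Rightarrow> nat) \<Rightarrow> (real^'n \<Rightarrow> complex) \<Rightarrow> complex" where
  "point_deriv \<omega> c \<alpha> h = (if h \<in> S_omega \<omega> then of_real c * multi_deriv \<alpha> h 0 else 0)"

text \<open>At the origin the weight exp(n \<omega>) equals 1, and \<open>R\<close> bounds M times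
  the Young conjugate, so exp(-R) is at most the factor that \<open>q_norm\<close> attaches to the
  derivative of order \<alpha>.\<close>

lemma point_deriv_le:
  assumes c: "c \<ge> 0" and M: "M \<ge> 1"
    and R: "\<And>\<tau>. \<tau> \<ge> 0 \<Longrightarrow> real (multi_order \<alpha>) * \<tau> - real M * \<omega> (exp \<tau>) \<le> R"
    and w: "\<omega> 0 = 0"
  shows "ennreal (norm (point_deriv \<omega> (c * exp (- R)) \<alpha> h)) \<le> ennreal c * q_norm \<omega> M n h"
proof -
  have "ennreal (norm (point_deriv \<omega> (c * exp (- R)) \<alpha> h)) \<le> ennreal (c * (norm (multi_deriv \<alpha> h 0) * exp (- R)))"
    using c unfolding point_deriv_def by (intro ennreal_leI) (auto simp: norm_mult)
  also have "\<dots> = ennreal c * (ennreal (norm (multi_deriv \<alpha> h 0)) * ennreal (exp (- R)))"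
    using c by (simp add: ennreal_mult)
  also have "\<dots> \<le> ennreal c * ((SUP x. ennreal (exp (real n * \<omega> (norm x)) * norm (multi_deriv \<alpha> h x))) *
     exp_ext (- (ereal (real M) * young_conj \<omega> (real (multi_order \<alpha>) / real M))))"
    by (intro mult_left_mono mult_mono exp_ext_young_ge M R SUP_upper2[of 0]) (auto simp: w)
  also have "\<dots> \<le> ennreal c * q_norm \<omega> M n h"
    unfolding q_norm_def by (intro mult_left_mono SUP_upper2[of \<alpha>]) auto
  finally show ?thesis .
qed

lemma point_deriv_in_dual:
  assumes c: "c \<ge> 0" and M: "M \<ge> 1"
    and R: "\<And>\<tau>. \<tau> \<ge> 0 \<Longrightarrow> real (multi_order \<alpha>) * \<tau> - real M * \<omega> (exp \<tau>) \<le> R"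
    and w: "\<omega> 0 = 0"
  shows "point_deriv \<omega> (c * exp (- R)) \<alpha> \<in> dual_space (S_omega \<omega>) (q_norms \<omega>)"
proof (rule bounded_functional_in_dual)
  show "q_norm \<omega> M 1 \<in> q_norms \<omega>"
    unfolding q_norms_def using M by auto
  fix f g :: "real^'a \<Rightarrow> complex" and a b assume f: "f \<in> S_omega \<omega>" and g: "g \<in> S_omega \<omega>"
  then have "smooth f" "smooth g"
    unfolding S_omega_def by auto
  then show "point_deriv \<omega> (c * exp (- R)) \<alpha> (\<lambda>x. a * f x + b * g x) =
      a * point_deriv \<omega> (c * exp (- R)) \<alpha> f + b * point_deriv \<omega> (c * exp (- R)) \<alpha> g"
    using S_omega_lincomb[OF f g] f g unfolding point_deriv_def
    by (simp add: multi_deriv_lincomb algebra_simps)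
next
  show "ennreal (norm (point_deriv \<omega> (c * exp (- R)) \<alpha> h)) \<le> ennreal c * q_norm \<omega> M 1 h" for h
    by (rule point_deriv_le[OF assms])
qed (auto simp: point_deriv_def c intro: S_omega_lincomb)

text \<open>The derivative of order \<alpha> of x -> exp(\<i> (\<eta>, x)); the wave itself belongs
  to the zero multi-index.\<close>

definition plane_wave :: "('n::finite \<Rightarrow> real) \<Rightarrow> ('n \<Rightarrow> nat) \<Rightarrow> real^'n \<Rightarrow> complex" where
  "plane_wave \<eta> = tensor (\<lambda>j k t. (\<i> * of_real (\<eta> j)) ^ k * exp (\<i> * of_real (\<eta> j) * of_real t))"

lemma deriv_seq_wave: "deriv_seq (\<lambda>k t. z ^ k * exp (z * of_real t))"
  unfolding deriv_seq_def
proof (intro allI)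
  fix k t
  have "((\<lambda>w. z ^ k * exp (z * w)) has_field_derivative z ^ Suc k * exp (z * of_real t)) (at (of_real t))"
    by (auto intro!: derivative_eq_intros)
  then show "((\<lambda>t. z ^ k * exp (z * of_real t)) has_vector_derivative z ^ Suc k * exp (z * of_real t)) (at t)"
    by (rule has_vector_derivative_real_field)
qed

lemma smooth_plane_wave: "smooth (plane_wave \<eta> \<alpha>)"
  unfolding plane_wave_def by (intro smooth_tensor deriv_seq_wave)

lemma multi_deriv_plane_wave: "multi_deriv \<alpha> (plane_wave \<eta> (\<lambda>_. 0)) = plane_wave \<eta> \<alpha>"
  unfolding plane_wave_def by (intro multi_deriv_tensor deriv_seq_wave)

lemma norm_plane_wave_le:
  assumes "\<And>j. \<bar>\<eta> j\<bar> \<le> \<xi>"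
  shows "norm (plane_wave \<eta> \<alpha> x) \<le> \<xi> ^ multi_order \<alpha>"
proof -
  have "norm (plane_wave \<eta> \<alpha> x) = (\<Prod>j\<in>UNIV. \<bar>\<eta> j\<bar> ^ \<alpha> j)"
    unfolding plane_wave_def tensor_def
    by (simp add: prod_norm[symmetric] norm_mult norm_power mult.assoc flip: of_real_mult)
  also have "\<dots> \<le> (\<Prod>j\<in>UNIV. \<xi> ^ \<alpha> j)"
    using assms by (intro prod_mono) (auto intro: power_mono)
  finally show ?thesis
    by (simp add: multi_order_def power_sum)
qed

text \<open>A derivative of order k has modulus at most exp(k t) times |c|. Inserting \<tau> = t in
  the conjugate cancels exp(k t), and exp(-n \<omega>) is at most 1.\<close>

lemma r_norm_plane_wave:
  assumes \<omega>: "\<forall>t\<ge>0. \<omega> t \<ge> 0" and m: "m \<ge> 1" and t: "t \<ge> 0" and \<eta>: "\<And>j. \<bar>\<eta> j\<bar> \<le> exp t"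
  shows "r_norm \<omega> m n (\<lambda>x. c * plane_wave \<eta> (\<lambda>_. 0) x) \<le> ennreal (norm c * exp (real m * \<omega> (exp t)))"
  unfolding r_norm_def multi_deriv_cmult[OF smooth_plane_wave] multi_deriv_plane_wave
proof (intro SUP_least)
  fix \<alpha> :: "'a \<Rightarrow> nat" and x :: "real^'a"
  let ?k = "multi_order \<alpha>"
  have "norm (c * plane_wave \<eta> \<alpha> x) \<le> norm c * exp t ^ ?k"
    unfolding norm_mult by (intro mult_left_mono norm_plane_wave_le \<eta>) auto
  then have 1: "ennreal (norm (c * plane_wave \<eta> \<alpha> x)) \<le> ennreal (norm c * exp (real ?k * t))"
    by (intro ennreal_leI) (simp add: exp_of_nat_mult)
  have 2: "exp_ext (ereal (- (real n * \<omega> (norm x))) - ereal (real m) * young_conj \<omega> (real ?k / real m))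
      \<le> ennreal (exp (- (real n * \<omega> (norm x)) - (real ?k * t - real m * \<omega> (exp t))))"
    by (rule exp_ext_young_le[OF m t])
  have "exp (real ?k * t) * exp (- (real n * \<omega> (norm x)) - (real ?k * t - real m * \<omega> (exp t)))
      \<le> exp (real m * \<omega> (exp t))"
    unfolding exp_add[symmetric] using \<omega> by simp
  then have 3: "norm c * exp (real ?k * t) * exp (- (real n * \<omega> (norm x)) - (real ?k * t - real m * \<omega> (exp t)))
      \<le> norm c * exp (real m * \<omega> (exp t))"
    unfolding mult.assoc by (intro mult_left_mono) auto
  have "ennreal (norm (c * plane_wave \<eta> \<alpha> x)) *
      exp_ext (ereal (- (real n * \<omega> (norm x))) - ereal (real m) * young_conj \<omega> (real ?k / real m))
      \<le> ennreal (norm c * exp (real ?k * t)) * ennreal (exp (- (real n * \<omega> (norm x)) - (real ?k * t - real m * \<omega> (exp t))))"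
    by (rule mult_mono[OF 1 2]) simp_all
  also have "\<dots> = ennreal (norm c * exp (real ?k * t) * exp (- (real n * \<omega> (norm x)) - (real ?k * t - real m * \<omega> (exp t))))"
    by (rule ennreal_mult[symmetric]) simp_all
  also have "\<dots> \<le> ennreal (norm c * exp (real m * \<omega> (exp t)))"
    using 3 by (rule ennreal_leI)
  finally show "ennreal (norm (c * plane_wave \<eta> \<alpha> x)) *
      exp_ext (ereal (- (real n * \<omega> (norm x))) - ereal (real m) * young_conj \<omega> (real ?k / real m))
      \<le> ennreal (norm c * exp (real m * \<omega> (exp t)))" .
qed

lemma plane_wave_times_gaussian:
  "plane_wave \<eta> (\<lambda>_. 0) x * gaussian (\<lambda>_. 0) (\<lambda>_. 0) x = gaussian (\<lambda>j. \<i> * of_real (\<eta> j)) (\<lambda>_. 0) x"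
  unfolding plane_wave_def tensor_def prod.distrib[symmetric] gauss_0
  by (intro prod.cong refl) (simp flip: exp_add)

section \<open>Failure of continuity at the origin\<close>

theorem proposition4p10:
  fixes \<omega> :: "real \<Rightarrow> real"
  assumes "nonquasianalytic_weight \<omega>"
  shows "\<not> continuous_map
           (prod_topology (O_M_topology \<omega> :: (real^'n::finite \<Rightarrow> complex) topology)
                          (S_dual_topology \<omega>))
           (S_dual_topology \<omega>)
           (\<lambda>(f, T). mult_dual \<omega> f T)"
proof
  assume cont: "continuous_map
           (prod_topology (O_M_topology \<omega> :: (real^'n \<Rightarrow> complex) topology) (S_dual_topology \<omega>))
           (S_dual_topology \<omega>) (\<lambda>(f, T). mult_dual \<omega> f T)"
  note w = assms
  note \<omega> = weight_nonneg[OF w]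
  have \<omega>0: "\<omega> 0 = 0"
    using weight_zero[OF w] by simp
  let ?dual = "dual_space (S_omega \<omega>) (q_norms \<omega>) :: ((real^'n \<Rightarrow> complex) \<Rightarrow> complex) set"
  let ?O = "O_M_topology \<omega> :: (real^'n \<Rightarrow> complex) topology"
  define G :: "real^'n \<Rightarrow> complex" where "G = gaussian (\<lambda>_. 0) (\<lambda>_. 0)"
  have G: "G \<in> S_omega \<omega>"
    using gaussian_in_S_omega[OF w, of "\<lambda>_. 0"] unfolding G_def by simp
  have bdd_G: "seminorm_bounded (S_omega \<omega>) (q_norms \<omega>) {G}"
    using G q_norm_gaussian_finite[OF w] unfolding seminorm_bounded_def q_norms_def G_def by auto
  \<comment> \<open>The open unit ball of the strong dual seminorm that belongs to the bounded set
    {G}.\<close>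
  define V where "V = {S \<in> ?dual. norm (S G) < 1}"
  have "openin (S_dual_topology \<omega>) V"
    unfolding S_dual_topology_def strong_dual_topology_def openin_seminorm_topology
  proof (intro conjI ballI)
    show "V \<subseteq> ?dual"
      unfolding V_def by auto
    fix u assume u: "u \<in> V"
    let ?p = "\<lambda>T. SUP g\<in>{G}. ennreal (norm (T g :: complex))"
    have ball: "v \<in> V" if v: "v \<in> ?dual" "?p (\<lambda>h. v h - u h) < ennreal (1 - norm (u G))" for v
    proof -
      have "norm (v G - u G) < 1 - norm (u G)"
        using v(2) by (simp add: ennreal_less_iff)
      then have "norm (v G) < 1"
        using norm_triangle_ineq2[of "v G" "u G"] by linarith
      then show ?thesis
        using v(1) unfolding V_def by simp
    qed
    have "?p \<in> {\<lambda>T. SUP g\<in>B. ennreal (norm (T g)) |B. seminorm_bounded (S_omega \<omega>) (q_norms \<omega>) B}"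
      using bdd_G by blast
    then have p: "{?p} \<subseteq> {\<lambda>T. SUP g\<in>B. ennreal (norm (T g)) |B. seminorm_bounded (S_omega \<omega>) (q_norms \<omega>) B}"
      by (simp only: insert_subset empty_subsetI simp_thms)
    have pos: "0 < 1 - norm (u G)"
      using u unfolding V_def by simp
    show "\<exists>F e. finite F \<and> F \<subseteq> {\<lambda>T. SUP g\<in>B. ennreal (norm (T g)) |B. seminorm_bounded (S_omega \<omega>) (q_norms \<omega>) B} \<and>
        0 < e \<and> (\<forall>v\<in>?dual. (\<forall>p\<in>F. p (\<lambda>x. v x - u x) < ennreal e) \<longrightarrow> v \<in> V)"
      by (intro exI[of _ "{?p}"] exI[of _ "1 - norm (u G)"] conjI finite.intros p pos ballI impI)
        (rule ball, assumption, erule bspec, rule singletonI)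
  qed
  moreover have top_dual: "topspace (S_dual_topology \<omega>) = ?dual"
    unfolding S_dual_topology_def strong_dual_topology_def by (rule topspace_seminorm_topology)
  ultimately have pre: "openin (prod_topology ?O (S_dual_topology \<omega>))
      {p \<in> topspace ?O \<times> ?dual. (case p of (f, T) \<Rightarrow> mult_dual \<omega> f T) \<in> V}"
    using cont unfolding continuous_map_def by simp
  have zero_O: "(\<lambda>x. 0) \<in> topspace ?O"
    unfolding topspace_O_M[OF \<omega>] by (auto simp: zero_in_O_step)
  have "(\<lambda>h. 0) \<in> ?dual"
    by (rule bounded_functional_in_dual[where q = "q_norm \<omega> 1 1" and C = 0])
      (auto simp: q_norms_def intro: S_omega_lincomb)
  moreover have "mult_dual \<omega> (\<lambda>x. 0) (\<lambda>h. 0) = (\<lambda>h::real^'n \<Rightarrow> complex. 0)"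
    by (auto simp: mult_dual_def)
  ultimately have zero: "((\<lambda>x. 0), (\<lambda>h. 0)) \<in> {p \<in> topspace ?O \<times> ?dual. (case p of (f, T) \<Rightarrow> mult_dual \<omega> f T) \<in> V}"
    using zero_O by (simp add: V_def)
  from pre[unfolded openin_prod_topology_alt, rule_format, OF zero]
  obtain U W where U: "openin ?O U" "(\<lambda>x. 0) \<in> U"
    and W: "openin (S_dual_topology \<omega>) W" "(\<lambda>h. 0) \<in> W"
    and sub: "U \<times> W \<subseteq> {p \<in> topspace ?O \<times> ?dual. (case p of (f, T) \<Rightarrow> mult_dual \<omega> f T) \<in> V}"
    by (elim exE conjE) (rule that)
  have UW: "mult_dual \<omega> f T \<in> V" if "f \<in> U" "T \<in> W" for f T
    using subsetD[OF sub SigmaI[OF that]] by simp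
  obtain m \<epsilon> where \<epsilon>: "\<epsilon> > 0" "\<forall>f \<in> topspace ?O. (\<forall>l\<in>{1..m}. r_norm \<omega> l 1 f < ennreal \<epsilon>) \<longrightarrow> f \<in> U"
    using O_M_nbhd_zero[OF \<omega> U] by (elim exE conjE) (rule that)
  \<comment> \<open>\<open>M\<close> depends only on \<omega> and on the level \<open>m\<close>
    fixed by \<open>U\<close>; the constant \<open>c\<close> below may depend on \<open>M\<close>,
    and the frequency is chosen last.\<close>
  obtain M :: nat where M: "M \<ge> 1"
    "\<And>L. \<exists>k t. t \<ge> 0 \<and> (\<forall>\<tau>\<ge>0. real k * \<tau> - real M * \<omega> (exp \<tau>) \<le> real k * t - real m * \<omega> (exp t) - L)"
    using weight_conj_gap[OF w, where m = m] by blast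
  have "q_norm \<omega> M 1 \<in> q_norms \<omega>"
    unfolding q_norms_def using M(1) by auto
  from strong_dual_nbhd_zero[OF W[unfolded S_dual_topology_def] this]
  obtain c where c: "c > 0"
    "\<forall>T \<in> ?dual. (\<forall>h\<in>S_omega \<omega>. ennreal (norm (T h)) \<le> ennreal c * q_norm \<omega> M 1 h) \<longrightarrow> T \<in> W"
    by blast
  \<comment> \<open>Chosen so that the final lower bound comes out as exactly 1.\<close>
  define L where "L = ln (2 / (\<epsilon> * c))"
  obtain k t where t: "t \<ge> 0"
    and kt: "\<And>\<tau>. \<tau> \<ge> 0 \<Longrightarrow> real k * \<tau> - real M * \<omega> (exp \<tau>) \<le> real k * t - real m * \<omega> (exp t) - L"
    using M(2)[of L] by blast
  define R where "R = real k * t - real m * \<omega> (exp t) - L"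
  \<comment> \<open>An arbitrary coordinate: the wave oscillates and the functional differentiates
    in this one direction.\<close>
  define i :: 'n where "i = undefined"
  define \<alpha> :: "'n \<Rightarrow> nat" where "\<alpha> j = (if j = i then k else 0)" for j
  define \<eta> :: "'n \<Rightarrow> real" where "\<eta> j = (if j = i then exp t else 0)" for j
  have order: "multi_order \<alpha> = k"
    unfolding multi_order_def \<alpha>_def by simp
  define T where "T = (point_deriv \<omega> (c * exp (- R)) \<alpha> :: (real^'n \<Rightarrow> complex) \<Rightarrow> complex)"
  have R: "real (multi_order \<alpha>) * \<tau> - real M * \<omega> (exp \<tau>) \<le> R" if "\<tau> \<ge> 0" for \<tau>
    using kt[OF that] unfolding order R_def .
  have "T \<in> ?dual"
    unfolding T_def using c(1) M(1) R \<omega>0 by (intro point_deriv_in_dual) auto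
  moreover have "ennreal (norm (T h)) \<le> ennreal c * q_norm \<omega> M 1 h" for h
    unfolding T_def using c(1) M(1) R \<omega>0 by (intro point_deriv_le) auto
  ultimately have "T \<in> W"
    using c(2) by blast
  \<comment> \<open>The exponential cancels the largest of the bounds for the levels up to
    \<open>m\<close>; the factor 1/2 makes the inequality strict.\<close>
  define b where "b = \<epsilon> / 2 * exp (- (real m * \<omega> (exp t)))"
  define f where "f = (\<lambda>x. of_real b * plane_wave \<eta> (\<lambda>_. 0) x)"
  have b: "b > 0"
    unfolding b_def using \<epsilon>(1) by simp
  have \<eta>: "\<bar>\<eta> j\<bar> \<le> exp t" for j
    unfolding \<eta>_def by simp
  have r: "r_norm \<omega> l 1 f \<le> ennreal (b * exp (real l * \<omega> (exp t)))" if "l \<ge> 1" for l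
    unfolding f_def using r_norm_plane_wave[OF \<omega> that t \<eta>, of 1 "of_real b"] b by simp
  have "smooth f"
    unfolding f_def by (intro smooth_cmult smooth_plane_wave)
  \<comment> \<open>Membership in the projective limit takes finiteness at every level, whereas
    smallness is asked only up to \<open>m\<close>.\<close>
  then have "f \<in> O_step \<omega> l 1" if "l \<ge> 1" for l
    using r[OF that] unfolding O_step_def by (auto intro: le_less_trans)
  then have "f \<in> topspace ?O"
    unfolding topspace_O_M[OF \<omega>] by auto
  moreover have "r_norm \<omega> l 1 f < ennreal \<epsilon>" if "l \<in> {1..m}" for l
  proof -
    have "real l * \<omega> (exp t) \<le> real m * \<omega> (exp t)"
      using that \<omega> by (intro mult_right_mono) auto
    then have "b * exp (real l * \<omega> (exp t)) \<le> b * exp (real m * \<omega> (exp t))"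
      using b by simp
    also have "\<dots> = \<epsilon> / 2"
      unfolding b_def by (simp add: exp_minus)
    finally have "ennreal (b * exp (real l * \<omega> (exp t))) < ennreal \<epsilon>"
      using \<epsilon>(1) by (intro ennreal_lessI) auto
    then show ?thesis
      using r[of l] that by (auto intro: le_less_trans)
  qed
  ultimately have "f \<in> U"
    using \<epsilon>(2) by blast
  then have "norm (mult_dual \<omega> f T G) < 1"
    using UW[OF _ \<open>T \<in> W\<close>] unfolding V_def by blast
  moreover have "norm (mult_dual \<omega> f T G) \<ge> 1"
  proof -
    define E :: "real^'n \<Rightarrow> complex" where "E = gaussian (\<lambda>j. \<i> * of_real (\<eta> j)) (\<lambda>_. 0)"
    \<comment> \<open>Multiplying the wave by the Gaussian gives a modulated Gaussian, so
      \<open>T\<close> is evaluated on an explicit function.\<close>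
    have fG: "(\<lambda>x. f x * G x) = (\<lambda>x. of_real b * E x)"
      unfolding f_def G_def E_def mult.assoc plane_wave_times_gaussian ..
    have "E \<in> S_omega \<omega>"
      unfolding E_def by (rule gaussian_in_S_omega[OF w])
    then have "mult_dual \<omega> f T G = of_real (c * exp (- R)) * (of_real b * multi_deriv \<alpha> E 0)"
      using G S_omega_cmult[of E \<omega> "of_real b"] unfolding mult_dual_def fG T_def point_deriv_def
      by (simp add: E_def multi_deriv_cmult smooth_gaussian)
    moreover have "multi_deriv \<alpha> E 0 = gauss (\<i> * of_real (exp t)) k 0"
    proof -
      have "multi_deriv \<alpha> E 0 = (\<Prod>j\<in>UNIV. gauss (\<i> * of_real (\<eta> j)) (\<alpha> j) 0)"
        unfolding E_def multi_deriv_gaussian tensor_def by simp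
      also have "\<dots> = gauss (\<i> * of_real (\<eta> i)) (\<alpha> i) 0 * (\<Prod>j\<in>UNIV - {i}. gauss (\<i> * of_real (\<eta> j)) (\<alpha> j) 0)"
        by (rule prod.remove) auto
      \<comment> \<open>In the other directions the factor has frequency 0, is not differentiated
        and has the value 1 at 0.\<close>
      also have "(\<Prod>j\<in>UNIV - {i}. gauss (\<i> * of_real (\<eta> j)) (\<alpha> j) 0) = 1"
        by (rule prod.neutral) (simp add: \<alpha>_def \<eta>_def gauss_0)
      finally have "multi_deriv \<alpha> E 0 = gauss (\<i> * of_real (\<eta> i)) (\<alpha> i) 0"
        by simp
      moreover have "\<alpha> i = k" "\<eta> i = exp t"
        by (simp_all add: \<alpha>_def \<eta>_def)
      ultimately show ?thesis
        by simp
    qed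
    ultimately have "norm (mult_dual \<omega> f T G) = c * exp (- R) * b * norm (gauss (\<i> * of_real (exp t)) k 0)"
      using c(1) b by (simp add: norm_mult)
    also have "\<dots> \<ge> c * exp (- R) * b * exp t ^ k"
      using c(1) b gauss_lower_bound[of "exp t" k] by (intro mult_left_mono) auto
    \<comment> \<open>The exponents -R, -m \<omega>(exp t) and k t add up to \<open>L\<close>, and
      exp L cancels the remaining factor c \<epsilon> / 2.\<close>
    also have "c * exp (- R) * b * exp t ^ k = 1"
    proof -
      have "c * exp (- R) * b * exp t ^ k = c * \<epsilon> / 2 * (exp (- R) * exp (- (real m * \<omega> (exp t))) * exp (real k * t))"
        unfolding b_def by (simp add: exp_of_nat_mult)
      also have "exp (- R) * exp (- (real m * \<omega> (exp t))) * exp (real k * t) = exp L"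
        unfolding exp_add[symmetric] R_def by simp
      also have "exp L = 2 / (\<epsilon> * c)"
        unfolding L_def using c(1) \<epsilon>(1) by simp
      finally show ?thesis
        using c(1) \<epsilon>(1) by simp
    qed
    finally show ?thesis .
  qed
  ultimately show False
    by simp
qed

end
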